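(* Consider quadratic regression with a covariate following the $t$-distribution with five degrees of freedom, with density $f_X$. There is a critical value $\alpha^*\approx0.082065$ of the subsampling proportion $\alpha\in(0,1)$ such that the $D$-optimal subsampling design $\xi^*$ of mass $\alpha$ has (i) density $f_{\xi^*}(x)=f_X(x)\,\mathbf{1}_{(-\infty,-a]\cup[-b,b]\cup[a,\infty)}(x)$ for some $a>b>0$, if $\alpha<\alpha^*$; (ii) density $f_{\xi^*}(x)=f_X(x)\,\mathbf{1}_{(-\infty,-t_{5,1-\alpha/2}]\cup[t_{5,1-\alpha/2},\infty)}(x)$, where $t_{5,1-\alpha/2}$ is the $(1-\alpha/2)$-quantile of the $t$-distribution with five degrees of freedom, if $\alpha\ge\alpha^*$.
   Context: Quadratic regression: $\mathbf{f}(x)=(1,x,x^2)^\top$. A (continuous) subsampling design $\xi$ of mass $\alpha$ is a measure on $\mathbb{R}$ with Lebesgue density $f_\xi$ satisfying $0\le f_\xi(x)\le f_X(x)$ for all $x$ and $\int f_\xi(x)\,dx=\alpha$ (densities are understood up to Lebesgue null sets). Its information matrix is $\mathbf{M}(\xi)=\int \mathbf{f}(x)\mathbf{f}(x)^\top f_\xi(x)\,dx$. The $D$-optimal subsampling design is the one maximizing $\log\det\mathbf{M}(\xi)$ among all subsampling designs $\xi$ of mass $\alpha$. $\mathbf{1}_A$ is the indicator function of $A$.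
   Formalization: The critical value is stated as within 0.000005 of 0.082065, not to all printed digits, since its actual value is about 0.082069 and the last printed digit is off. *)

theory Defs
  imports "HOL-Probability.Probability"
begin

definition student_t_density :: "real \<Rightarrow> real \<Rightarrow> real" where
  "student_t_density \<nu> x =
     Gamma ((\<nu> + 1) / 2) / (sqrt (\<nu> * pi) * Gamma (\<nu> / 2)) *
     (1 + x\<^sup>2 / \<nu>) powr (- ((\<nu> + 1) / 2))"

definition student_t :: "real \<Rightarrow> real measure" where
  "student_t \<nu> = density lborel (\<lambda>x. ennreal (student_t_density \<nu> x))"

definition quantile :: "real measure \<Rightarrow> real \<Rightarrow> real" where
  "quantile M p = Inf {x. p \<le> cdf M x}"

definition qreg :: "real \<Rightarrow> real^3" where
  "qreg x = vector [1, x, x\<^sup>2]"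

(* A design is the measure itself, so designs whose densities agree up to null sets are equal.
   The pointwise bound on some version g of the density is no stronger than an almost
   everywhere bound, since a version can be changed on a null set. *)
definition subsampling_design :: "(real \<Rightarrow> real) \<Rightarrow> real \<Rightarrow> real measure \<Rightarrow> bool" where
  "subsampling_design fX \<alpha> \<xi> \<longleftrightarrow>
     (\<exists>g. g \<in> borel_measurable borel \<and> (\<forall>x. 0 \<le> g x \<and> g x \<le> fX x) \<and>
          has_bochner_integral lborel g \<alpha> \<and>
          \<xi> = density lborel (\<lambda>x. ennreal (g x)))"

definition info_matrix :: "real measure \<Rightarrow> real^3^3" where
  "info_matrix \<xi> = (\<chi> i j. LINT x|\<xi>. qreg x $ i * qreg x $ j)"

lemma info_matrix_density:
  assumes "g \<in> borel_measurable borel" "\<And>x. 0 \<le> g x"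
  shows "info_matrix (density lborel (\<lambda>x. ennreal (g x))) =
           (\<chi> i j. LINT x|lborel. qreg x $ i * qreg x $ j * g x)"
proof -
  have "(\<lambda>x. qreg x $ i) \<in> borel_measurable borel" for i
    using exhaust_3[of i] by (auto simp: qreg_def vector_3)
  then show ?thesis
    using assms by (simp add: info_matrix_def integral_real_density mult.commute)
qed

(* For a positive mass the information matrix of a design with finite fourth moment is positive
   definite (a nonzero quadratic polynomial vanishes at no more than two points), so that
   ln is only applied to positive determinants and the convention ln 0 = 0 plays no role. *)
definition D_optimal :: "(real \<Rightarrow> real) \<Rightarrow> real \<Rightarrow> real measure \<Rightarrow> bool" where
  "D_optimal fX \<alpha> \<xi> \<longleftrightarrow>
     subsampling_design fX \<alpha> \<xi> \<and>
     (\<forall>\<eta>. subsampling_design fX \<alpha> \<eta> \<longrightarrow> ln (det (info_matrix \<eta>)) \<le> ln (det (info_matrix \<xi>)))"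

end

(*
  By symmetry of the density the odd moments of a candidate design vanish, and by Fischer's
  inequality det M <= m2 (m0 m4 - m2^2) for every design. The logarithm of the right-hand side is
  concave, so a candidate is optimal as soon as it keeps exactly the points where its sensitivity
  function, a quadratic polynomial in x^2, is above a level; equality in the bathtub
  principle gives uniqueness.

  Substituting x = sqrt 5 * cot (y / 2) turns the tail moments of the t-distribution into
  combinations of y, sin y and sin (2 y). The two-tailed design at angle y is then optimal if and
  only if crit y >= 0, where crit is a quadratic polynomial in y with trigonometric coefficients.
  It is negative while cos y >= 1/8 and increasing afterwards, hence changes sign exactly once, at
  an angle slightly above pi / 2. Where crit y < 0, the intermediate value theorem, applied along
  the curve of pairs (a, b) giving the prescribed mass, yields thresholds at which the
  sensitivity function takes the same value.
*)
theory Submission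
  imports Defs
begin

section \<open>Optimality of threshold designs\<close>

abbreviation moment :: "(real \<Rightarrow> real) \<Rightarrow> nat \<Rightarrow> real" where
  "moment g k \<equiv> LINT x|lborel. x ^ k * g x"

section \<open>Moments and determinants of information matrices\<close>

lemma det_info_matrix:
  assumes "g \<in> borel_measurable borel" "\<And>x. 0 \<le> g x"
  shows "det (info_matrix (density lborel (\<lambda>x. ennreal (g x)))) =
    moment g 0 * moment g 2 * moment g 4 + 2 * moment g 1 * moment g 2 * moment g 3
      - moment g 2 ^ 3 - moment g 0 * (moment g 3)\<^sup>2 - (moment g 1)\<^sup>2 * moment g 4"
proof -
  have eq: "qreg x $ 1 * qreg x $ 1 = x ^ 0" "qreg x $ 1 * qreg x $ 2 = x ^ 1"
    "qreg x $ 1 * qreg x $ 3 = x ^ 2" "qreg x $ 2 * qreg x $ 1 = x ^ 1"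
    "qreg x $ 2 * qreg x $ 2 = x ^ 2" "qreg x $ 2 * qreg x $ 3 = x ^ 3"
    "qreg x $ 3 * qreg x $ 1 = x ^ 2" "qreg x $ 3 * qreg x $ 2 = x ^ 3"
    "qreg x $ 3 * qreg x $ 3 = x ^ 4" for x
    by (simp_all add: qreg_def vector_3 power2_eq_square power3_eq_cube power4_eq_xxxx)
  show ?thesis
    unfolding info_matrix_density[OF assms] det_3 vec_lambda_beta eq
    by (simp add: power2_eq_square power3_eq_cube algebra_simps)
qed

lemma integrable_moment:
  fixes f g :: "real \<Rightarrow> real"
  assumes "g \<in> borel_measurable borel" "\<And>x. 0 \<le> g x \<and> g x \<le> f x"
    and "integrable lborel f" "integrable lborel (\<lambda>x. x ^ 4 * f x)" "k \<le> 4"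
  shows "integrable lborel (\<lambda>x. x ^ k * g x)"
proof (rule Bochner_Integration.integrable_bound)
  show "integrable lborel (\<lambda>x. f x + x ^ 4 * f x)"
    using assms by simp
  have "\<bar>x\<bar> ^ k * g x \<le> f x + x ^ 4 * f x" for x
  proof -
    \<comment> \<open>This bound, by cases on \<open>\<bar>x\<bar> \<le> 1\<close>, lets the zeroth
      and fourth moment of \<open>f\<close> dominate all moments in between.\<close>
    have "\<bar>x\<bar> ^ k \<le> 1 + x ^ 4"
    proof (cases "\<bar>x\<bar> \<le> 1")
      case True
      then show ?thesis using power_le_one[of "\<bar>x\<bar>" k] by (simp add: add_increasing2)
    next
      case False
      then have "\<bar>x\<bar> ^ k \<le> \<bar>x\<bar> ^ 4" using assms(5) by (intro power_increasing) auto
      then show ?thesis by simp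
    qed
    then have "\<bar>x\<bar> ^ k * g x \<le> (1 + x ^ 4) * f x"
      using assms(2)[of x] by (intro mult_mono) auto
    then show ?thesis by (simp add: algebra_simps)
  qed
  moreover have "0 \<le> f x" for x using assms(2)[of x] by linarith
  ultimately show "AE x in lborel. norm (x ^ k * g x) \<le> norm (f x + x ^ 4 * f x)"
    using assms(2) by (auto simp: abs_mult power_abs)
qed (use assms(1) in simp)

lemma has_bochner_integral_nonneg:
  fixes f :: "'a \<Rightarrow> real"
  shows "has_bochner_integral M f x \<Longrightarrow> (\<And>y. 0 \<le> f y) \<Longrightarrow> 0 \<le> x"
  using Bochner_Integration.integral_nonneg[of M f] by (simp add: has_bochner_integral_iff)

lemma AE_lborel_finite: "finite (A :: real set) \<Longrightarrow> AE x in lborel. x \<notin> A"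
  by (intro AE_not_in countable_imp_null_set_lborel) (auto intro: countable_finite)

text \<open>The form is the integral of the squared polynomial \<open>A + B * x + C * x^2\<close>
  against \<open>g\<close>. If it were zero, \<open>g\<close> would vanish almost everywhere,
  because a nonzero polynomial has finitely many roots, contrary to the positive mass.\<close>

lemma quadratic_form_moments_pos:
  fixes g :: "real \<Rightarrow> real"
  assumes g: "\<And>x. 0 \<le> g x"
    and int: "\<And>k. k \<le> 4 \<Longrightarrow> integrable lborel (\<lambda>x. x ^ k * g x)"
    and pos: "0 < moment g 0" and nz: "A \<noteq> 0 \<or> B \<noteq> 0 \<or> C \<noteq> 0"
  shows "0 < A\<^sup>2 * moment g 0 + 2 * A * B * moment g 1 + (B\<^sup>2 + 2 * A * C) * moment g 2
           + 2 * B * C * moment g 3 + C\<^sup>2 * moment g 4"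
proof -
  let ?p = "\<lambda>x. A + B * x + C * x\<^sup>2"
  have hb: "has_bochner_integral lborel (\<lambda>x. x ^ k * g x) (moment g k)" if "k \<le> 4" for k
    using int[OF that] by (rule has_bochner_integral_integrable)
  have "has_bochner_integral lborel
      (\<lambda>x. A\<^sup>2 * (x ^ 0 * g x) + 2 * A * B * (x ^ 1 * g x) + (B\<^sup>2 + 2 * A * C) * (x ^ 2 * g x)
           + 2 * B * C * (x ^ 3 * g x) + C\<^sup>2 * (x ^ 4 * g x))
      (A\<^sup>2 * moment g 0 + 2 * A * B * moment g 1 + (B\<^sup>2 + 2 * A * C) * moment g 2
           + 2 * B * C * moment g 3 + C\<^sup>2 * moment g 4)" (is "has_bochner_integral _ ?h ?I")
    by (intro has_bochner_integral_add has_bochner_integral_mult_right hb) auto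
  moreover have "?h = (\<lambda>x. (?p x)\<^sup>2 * g x)"
    by (rule ext) algebra
  ultimately have I: "has_bochner_integral lborel (\<lambda>x. (?p x)\<^sup>2 * g x) ?I" by simp
  have nn: "0 \<le> (?p x)\<^sup>2 * g x" for x using g by simp
  have "?I \<ge> 0"
    using nn has_bochner_integral_nonneg[OF I] by blast
  moreover have "?I \<noteq> 0"
  proof
    assume "?I = 0"
    then have "AE x in lborel. (?p x)\<^sup>2 * g x = 0"
      using I nn integral_nonneg_eq_0_iff_AE[of lborel "\<lambda>x. (?p x)\<^sup>2 * g x"]
      by (auto simp: has_bochner_integral_iff)
    moreover have "finite {x. ?p x = 0}"
    proof -
      have "{x. ?p x = 0} = {x. poly [:A, B, C:] x = 0}"
        by (simp add: power2_eq_square algebra_simps)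
      moreover have "[:A, B, C:] \<noteq> 0" using nz by simp
      ultimately show ?thesis using poly_roots_finite[of "[:A, B, C:]"] by (simp only: not_False_eq_True)
    qed
    note AE_lborel_finite[OF this]
    ultimately have "AE x in lborel. g x = 0" by eventually_elim simp
    then have "moment g 0 = 0"
      by (subst integral_cong_AE[where g = "\<lambda>_. 0"]) (use int[of 0] in auto)
    then show False using pos by simp
  qed
  ultimately show ?thesis by linarith
qed

text \<open>The quadratic form is evaluated at the vector of cofactors of the last row: \<open>M v = (0, 0, det M)\<close>.\<close>

lemma det_moments_pos:
  fixes g :: "real \<Rightarrow> real"
  assumes "\<And>x. 0 \<le> g x" "\<And>k. k \<le> 4 \<Longrightarrow> integrable lborel (\<lambda>x. x ^ k * g x)" "0 < moment g 0"
  shows "0 < moment g 0 * moment g 2 * moment g 4 + 2 * moment g 1 * moment g 2 * moment g 3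
      - moment g 2 ^ 3 - moment g 0 * (moment g 3)\<^sup>2 - (moment g 1)\<^sup>2 * moment g 4" (is "0 < ?D")
proof -
  note form = quadratic_form_moments_pos[OF assms]
  let ?m = "moment g"
  let ?V = "?m 0 * ?m 2 - (?m 1)\<^sup>2"
  have "0 < ?m 0 * ?V"
    using form[of "- ?m 1" "?m 0" 0] assms(3)
    by (simp add: power2_eq_square algebra_simps)
  then have V: "0 < ?V" using assms(3) zero_less_mult_pos by blast
  have "0 < (?m 1 * ?m 3 - (?m 2)\<^sup>2)\<^sup>2 * ?m 0
      + 2 * (?m 1 * ?m 3 - (?m 2)\<^sup>2) * (?m 1 * ?m 2 - ?m 0 * ?m 3) * ?m 1
      + ((?m 1 * ?m 2 - ?m 0 * ?m 3)\<^sup>2 + 2 * (?m 1 * ?m 3 - (?m 2)\<^sup>2) * ?V) * ?m 2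
      + 2 * (?m 1 * ?m 2 - ?m 0 * ?m 3) * ?V * ?m 3 + ?V\<^sup>2 * ?m 4"
    using V by (intro form) auto
  also have "\<dots> = ?V * ?D" by algebra
  finally show ?thesis using V zero_less_mult_pos by blast
qed

text \<open>The quadratic form is evaluated at \<open>(0, 1, 0)\<close> and at
  \<open>(- m2, 0, m0)\<close>.\<close>

lemma variance_moments_pos:
  fixes g :: "real \<Rightarrow> real"
  assumes "\<And>x. 0 \<le> g x" "\<And>k. k \<le> 4 \<Longrightarrow> integrable lborel (\<lambda>x. x ^ k * g x)" "0 < moment g 0"
  shows "0 < moment g 2" "0 < moment g 0 * moment g 4 - (moment g 2)\<^sup>2"
proof -
  note form = quadratic_form_moments_pos[OF assms]
  show "0 < moment g 2" using form[of 0 1 0] by simp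
  have "0 < moment g 0 * (moment g 0 * moment g 4 - (moment g 2)\<^sup>2)"
    using form[of "- moment g 2" 0 "moment g 0"] assms(3)
    by (simp add: power2_eq_square algebra_simps)
  then show "0 < moment g 0 * moment g 4 - (moment g 2)\<^sup>2"
    using assms(3) zero_less_mult_pos by blast
qed

text \<open>Fischer's inequality for the even and odd part of the regression function.\<close>

lemma det_moments_le:
  fixes m0 m1 m2 m3 m4 :: real
  assumes "0 < m0" "m2\<^sup>2 < m0 * m4"
  shows "m0 * m2 * m4 + 2 * m1 * m2 * m3 - m2 ^ 3 - m0 * m3\<^sup>2 - m1\<^sup>2 * m4 \<le> m2 * (m0 * m4 - m2\<^sup>2)"
proof -
  have "m0 * (m0 * m3\<^sup>2 + m1\<^sup>2 * m4 - 2 * m1 * m2 * m3)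
      = (m0 * m3 - m1 * m2)\<^sup>2 + m1\<^sup>2 * (m0 * m4 - m2\<^sup>2)" by algebra
  moreover have "\<dots> \<ge> 0" using assms by simp
  ultimately have "0 \<le> m0 * m3\<^sup>2 + m1\<^sup>2 * m4 - 2 * m1 * m2 * m3"
    using assms(1) by (metis zero_le_mult_iff less_le_not_le)
  then show ?thesis by (simp add: algebra_simps power2_eq_square power3_eq_cube)
qed

text \<open>The linear form \<open>m0 n4 - k n2\<close> is, up to a positive factor, the derivative of
  \<open>ln (n2 (m0 n4 - n2\<^sup>2))\<close> at \<open>(m2, m4)\<close>, and this function is concave.\<close>

lemma det_tangent_bound:
  fixes m0 m2 m4 n2 n4 k :: real
  defines "D \<equiv> m0 * m4 - m2\<^sup>2"
  assumes "0 < m2" "0 < D" "0 < n2" and k: "k * m2 = 3 * m2\<^sup>2 - m0 * m4"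
    and dir: "m0 * n4 - k * n2 \<le> m0 * m4 - k * m2"
  shows "n2 * (m0 * n4 - n2\<^sup>2) \<le> m2 * D"
    and "m0 * n4 - k * n2 < m0 * m4 - k * m2 \<Longrightarrow> n2 * (m0 * n4 - n2\<^sup>2) < m2 * D"
proof -
  define e where "e = (m0 * m4 - k * m2) - (m0 * n4 - k * n2)"
  have "e \<ge> 0" using dir by (simp add: e_def)
  have "m2 * (m2 * D - n2 * (m0 * n4 - n2\<^sup>2) - n2 * e) = D * (n2 - m2)\<^sup>2 + m2 * n2 * (n2 - m2)\<^sup>2"
    unfolding e_def D_def using k by algebra
  moreover have "\<dots> \<ge> 0" using assms by simp
  ultimately have *: "n2 * e \<le> m2 * D - n2 * (m0 * n4 - n2\<^sup>2)"
    using \<open>0 < m2\<close> by (smt (verit) mult_pos_neg)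
  moreover have "0 \<le> n2 * e" using \<open>e \<ge> 0\<close> assms by simp
  ultimately show "n2 * (m0 * n4 - n2\<^sup>2) \<le> m2 * D" by linarith
  assume "m0 * n4 - k * n2 < m0 * m4 - k * m2"
  then have "0 < n2 * e" using assms by (simp add: e_def)
  with * show "n2 * (m0 * n4 - n2\<^sup>2) < m2 * D" by linarith
qed

text \<open>Up to a positive factor, \<open>(x^2 - a^2) * (x^2 - d)\<close> is the sensitivity
  function minus its level at \<open>a\<close>: \<open>eq\<close> says that
  \<open>\<alpha> * (a^2 + d)\<close> is the constant \<open>k\<close> of
  \<open>det_tangent_bound\<close>. The design with support \<open>S\<close> therefore maximizes the
  tangent form by the bathtub principle. The second root is a real \<open>d\<close> and not a
  square, so that \<open>d \<le> 0\<close> covers the designs without a central piece.\<close>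

theorem D_optimal_iff_threshold:
  fixes f :: "real \<Rightarrow> real" and S :: "real set" and \<alpha> a d :: real
  defines "g \<equiv> \<lambda>x. f x * indicator S x"
  assumes f: "f \<in> borel_measurable borel" "\<And>x. 0 \<le> f x" "\<And>x. f (- x) = f x"
    and int: "integrable lborel f" "integrable lborel (\<lambda>x. x ^ 4 * f x)"
    and S: "S \<in> sets borel" "\<And>x. - x \<in> S \<longleftrightarrow> x \<in> S"
      "\<And>x. 0 < (x\<^sup>2 - a\<^sup>2) * (x\<^sup>2 - d) \<Longrightarrow> x \<in> S" "\<And>x. (x\<^sup>2 - a\<^sup>2) * (x\<^sup>2 - d) < 0 \<Longrightarrow> x \<notin> S"
    and \<alpha>: "0 < \<alpha>" "moment g 0 = \<alpha>"
    and eq: "\<alpha> * (a\<^sup>2 + d) * moment g 2 = 3 * (moment g 2)\<^sup>2 - \<alpha> * moment g 4"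
  shows "D_optimal f \<alpha> \<xi> \<longleftrightarrow> \<xi> = density lborel (\<lambda>x. ennreal (f x * indicator S x))"
proof -
  let ?m = "moment g" and ?det = "\<lambda>\<xi>. det (info_matrix \<xi>)" and ?\<xi> = "density lborel (\<lambda>x. ennreal (g x))"
  have g: "g \<in> borel_measurable borel" "\<And>x. 0 \<le> g x \<and> g x \<le> f x"
    using f S(1) by (auto simp: g_def indicator_def)
  note g_int = integrable_moment[OF g int]
  have g_hb: "has_bochner_integral lborel (\<lambda>x. x ^ k * g x) (?m k)" if "k \<le> 4" for k
    using g_int[OF that] by (rule has_bochner_integral_integrable)
  have design: "subsampling_design f \<alpha> ?\<xi>"
    using g g_hb[of 0] \<alpha> unfolding subsampling_design_def by (intro exI[of _ g]) auto
  have odd: "?m k = 0" if "odd k" "k \<le> 4" for k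
  proof -
    have gs: "g (- x) = g x" for x
      using f(3) S(2) by (simp add: g_def indicator_def)
    have "integrable lborel (\<lambda>x. indicator {0..} x *\<^sub>R (x ^ k * g x))"
      using g_int[OF that(2)] by (intro integrable_mult_indicator) auto
    then have "has_bochner_integral lborel (\<lambda>x. x ^ k * g x) 0"
      by (intro has_bochner_integral_odd_function[OF has_bochner_integral_integrable])
         (use that gs in auto)
    then show ?thesis by (rule has_bochner_integral_integral_eq)
  qed
  have m_pos: "0 < ?m 2" "0 < \<alpha> * ?m 4 - (?m 2)\<^sup>2"
    using variance_moments_pos[of g] g g_int \<alpha> by auto
  have det_g: "?det ?\<xi> = ?m 2 * (\<alpha> * ?m 4 - (?m 2)\<^sup>2)"
  proof -
    have "?m 1 = 0" "?m 3 = 0" by (rule odd; simp)+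
    moreover have "?det ?\<xi> = ?m 0 * ?m 2 * ?m 4 + 2 * ?m 1 * ?m 2 * ?m 3
      - ?m 2 ^ 3 - ?m 0 * (?m 3)\<^sup>2 - (?m 1)\<^sup>2 * ?m 4"
      using g by (intro det_info_matrix) auto
    ultimately show ?thesis using \<alpha>(2) by algebra
  qed
  have det_g_pos: "0 < ?det ?\<xi>" using m_pos by (simp add: det_g)
  \<comment> \<open>Positivity makes \<open>ln\<close> strictly monotone on the determinants
    concerned, the inequality gives optimality, and the last clause gives uniqueness.\<close>
  have other: "0 < ?det (density lborel (\<lambda>x. ennreal (h x))) \<and>
      ?det (density lborel (\<lambda>x. ennreal (h x))) \<le> ?det ?\<xi> \<and>
      (?det (density lborel (\<lambda>x. ennreal (h x))) = ?det ?\<xi> \<longrightarrow> (AE x in lborel. h x = g x))"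
    if h: "h \<in> borel_measurable borel" "\<And>x. 0 \<le> h x \<and> h x \<le> f x"
      and h_mass: "has_bochner_integral lborel h \<alpha>" for h
  proof -
    let ?n = "moment h" and ?d = "?det (density lborel (\<lambda>x. ennreal (h x)))"
    define k where "k = \<alpha> * (a\<^sup>2 + d)"
    note h_int = integrable_moment[OF h int]
    have h_hb: "has_bochner_integral lborel (\<lambda>x. x ^ k * h x) (?n k)" if "k \<le> 4" for k
      using h_int[OF that] by (rule has_bochner_integral_integrable)
    have n0: "?n 0 = \<alpha>" using h_mass by (simp add: has_bochner_integral_iff)
    have n_pos: "0 < ?n 2" "0 < \<alpha> * ?n 4 - (?n 2)\<^sup>2"
      using variance_moments_pos[of h] h h_int n0 \<alpha>(1) by auto
    have d_eq: "?d = ?n 0 * ?n 2 * ?n 4 + 2 * ?n 1 * ?n 2 * ?n 3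
      - ?n 2 ^ 3 - ?n 0 * (?n 3)\<^sup>2 - (?n 1)\<^sup>2 * ?n 4"
      using h by (intro det_info_matrix) auto
    have d_pos: "0 < ?d"
      unfolding d_eq by (intro det_moments_pos) (use h h_int n0 \<alpha>(1) in auto)
    have d_le: "?d \<le> ?n 2 * (\<alpha> * ?n 4 - (?n 2)\<^sup>2)"
      unfolding d_eq n0 using n_pos \<alpha>(1) by (intro det_moments_le) auto
    \<comment> \<open>The bathtub integrand: on \<open>S\<close> both the polynomial and
      \<open>g - h\<close> are nonnegative, off \<open>S\<close> both are nonpositive.\<close>
    define q where "q = (\<lambda>x::real. (x\<^sup>2 - a\<^sup>2) * (x\<^sup>2 - d) * (g x - h x))"
    have q_nn: "0 \<le> q x" for x
    proof (cases "x \<in> S")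
      case True
      then have "0 \<le> (x\<^sup>2 - a\<^sup>2) * (x\<^sup>2 - d)" using S(4)[of x] by (meson not_less)
      then show ?thesis using True h(2)[of x] by (simp add: q_def g_def)
    next
      case False
      then have "(x\<^sup>2 - a\<^sup>2) * (x\<^sup>2 - d) \<le> 0" using S(3)[of x] by (meson not_less)
      then show ?thesis using False h(2)[of x]
        by (simp add: q_def g_def mult_nonpos_nonneg)
    qed
    \<comment> \<open>Both designs have mass \<open>\<alpha>\<close>, so the constant
      \<open>a^2 * d\<close> contributes nothing, and \<open>\<alpha>\<close> times the integral of
      \<open>q\<close> is the difference of the tangent forms.\<close>
    have "has_bochner_integral lborel
       (\<lambda>x. ((x ^ 4 * g x) - (x ^ 4 * h x)) - (a\<^sup>2 + d) * ((x ^ 2 * g x) - (x ^ 2 * h x))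
            + a\<^sup>2 * d * ((x ^ 0 * g x) - (x ^ 0 * h x)))
       ((?m 4 - ?n 4) - (a\<^sup>2 + d) * (?m 2 - ?n 2) + a\<^sup>2 * d * (?m 0 - ?n 0))"
      (is "has_bochner_integral _ ?q ?I")
      by (intro has_bochner_integral_add has_bochner_integral_diff has_bochner_integral_mult_right
            g_hb h_hb) auto
    moreover have "?q = q" unfolding q_def by (rule ext) algebra
    moreover have "?I = (?m 4 - ?n 4) - (a\<^sup>2 + d) * (?m 2 - ?n 2)"
      unfolding n0 \<alpha>(2) by simp
    ultimately have q_hb: "has_bochner_integral lborel q ((?m 4 - ?n 4) - (a\<^sup>2 + d) * (?m 2 - ?n 2))"
      by (simp only:)
    then have I: "0 \<le> (?m 4 - ?n 4) - (a\<^sup>2 + d) * (?m 2 - ?n 2)"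
      using q_nn has_bochner_integral_nonneg by blast
    then have "0 \<le> \<alpha> * ((?m 4 - ?n 4) - (a\<^sup>2 + d) * (?m 2 - ?n 2))" using \<alpha>(1) by simp
    then have dir: "\<alpha> * ?n 4 - k * ?n 2 \<le> \<alpha> * ?m 4 - k * ?m 2"
      by (simp add: k_def algebra_simps)
    have k: "k * ?m 2 = 3 * (?m 2)\<^sup>2 - \<alpha> * ?m 4" using eq by (simp add: k_def)
    note bounds = det_tangent_bound[OF m_pos(1,2) n_pos(1) k dir]
    have le: "?d \<le> ?det ?\<xi>" using d_le bounds(1) det_g by linarith
    moreover have "AE x in lborel. h x = g x" if "?d = ?det ?\<xi>"
    proof -
      \<comment> \<open>Equal determinants rule out the strict tangent bound, so \<open>q\<close>
        has integral zero; away from the at most four roots of the polynomial this forces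
        \<open>h = g\<close>.\<close>
      have "\<not> \<alpha> * ?n 4 - k * ?n 2 < \<alpha> * ?m 4 - k * ?m 2"
        using that d_le bounds(2) det_g by linarith
      then have "\<alpha> * ((?m 4 - ?n 4) - (a\<^sup>2 + d) * (?m 2 - ?n 2)) = 0"
        using dir by (simp add: k_def algebra_simps)
      then have "(?m 4 - ?n 4) - (a\<^sup>2 + d) * (?m 2 - ?n 2) = 0" using \<alpha>(1) by simp
      then have "AE x in lborel. q x = 0"
        using q_hb q_nn integral_nonneg_eq_0_iff_AE[of lborel q]
        by (auto simp: has_bochner_integral_iff)
      moreover have "AE x in lborel. x \<notin> {a, - a, sqrt d, - sqrt d}"
        by (intro AE_lborel_finite) auto
      ultimately show ?thesis
      proof eventually_elim
        case (elim x)
        have "x\<^sup>2 \<noteq> a\<^sup>2" using elim by (simp add: power2_eq_iff)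
        moreover have "x\<^sup>2 \<noteq> d"
        proof
          assume "x\<^sup>2 = d"
          then have "sqrt d = \<bar>x\<bar>" by auto
          then show False using elim by auto
        qed
        ultimately show ?case using elim by (simp add: q_def)
      qed
    qed
    ultimately show ?thesis using d_pos by blast
  qed
  have gx: "f x * indicator S x = g x" for x by (simp add: g_def)
  show ?thesis unfolding gx
  proof
    assume "\<xi> = ?\<xi>"
    moreover have "ln (?det \<eta>) \<le> ln (?det ?\<xi>)" if "subsampling_design f \<alpha> \<eta>" for \<eta>
      using that other unfolding subsampling_design_def by (auto intro!: ln_mono)
    ultimately show "D_optimal f \<alpha> \<xi>"
      using design by (simp add: D_optimal_def)
  next
    assume opt: "D_optimal f \<alpha> \<xi>"
    then obtain h where h: "h \<in> borel_measurable borel" "\<And>x. 0 \<le> h x \<and> h x \<le> f x"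
      "has_bochner_integral lborel h \<alpha>" and \<xi>: "\<xi> = density lborel (\<lambda>x. ennreal (h x))"
      unfolding D_optimal_def subsampling_design_def by blast
    have "ln (?det ?\<xi>) \<le> ln (?det \<xi>)" using opt design by (simp add: D_optimal_def)
    then have "?det ?\<xi> \<le> ?det \<xi>" using other[OF h] det_g_pos \<xi> by simp
    then have "AE x in lborel. h x = g x" using other[OF h] \<xi> by fastforce
    then show "\<xi> = ?\<xi>" unfolding \<xi> using h g by (intro density_cong) auto
  qed
qed

section \<open>The sign of the criterion\<close>

lemma arctan_less_pade:
  assumes "0 < (t::real)"
  shows "arctan t < t * (15 + 4 * t\<^sup>2) / (15 + 9 * t\<^sup>2)"
proof -
  let ?f = "\<lambda>t::real. t * (15 + 4 * t\<^sup>2) / (15 + 9 * t\<^sup>2) - arctan t"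
  \<comment> \<open>The quotient is the Pade approximant that agrees with \<open>arctan\<close> up
    to order 5, hence the derivative of the difference begins with \<open>t ^ 6\<close>.\<close>
  let ?f' = "\<lambda>t::real. 36 * t ^ 6 / ((15 + 9 * t\<^sup>2)\<^sup>2 * (1 + t\<^sup>2))"
  have nz: "15 + 9 * x\<^sup>2 \<noteq> 0" "1 + x\<^sup>2 \<noteq> 0" for x :: real
    by (smt (verit) zero_le_power2)+
  have "(?f has_real_derivative ?f' x) (at x)" for x
    by (rule derivative_eq_intros refl | simp add: nz)+ (simp add: nz divide_simps, algebra)
  moreover have "0 < ?f' x" if "0 < x" for x :: real
    using that by (intro divide_pos_pos mult_pos_pos zero_less_power add_pos_pos) auto
  ultimately have "?f 0 < ?f t"
    using assms by (intro DERIV_pos_imp_increasing_open[of 0 t ?f])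
      (auto intro!: continuous_intros simp: nz)
  then show ?thesis by simp
qed

lemma arctan_less_self: "0 < t \<Longrightarrow> arctan t < (t::real)"
proof -
  assume t: "0 < t"
  then have "t * (15 + 4 * t\<^sup>2) / (15 + 9 * t\<^sup>2) \<le> t"
    by (subst pos_divide_le_eq) (auto simp: add_pos_nonneg algebra_simps)
  then show ?thesis using arctan_less_pade[OF t] by linarith
qed

text \<open>The derivative of the polynomial is a partial sum of the geometric series for
  \<open>1 / (1 + x^2)\<close>, so the remainder has a derivative of constant sign.\<close>

lemma arctan_taylor_bounds:
  fixes t :: real
  assumes "0 \<le> t"
  shows "t - t^3/3 + t^5/5 - t^7/7 + t^9/9 - t^11/11 \<le> arctan t"
    and "arctan t \<le> t - t^3/3 + t^5/5 - t^7/7 + t^9/9"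
proof -
  have nz: "1 + x\<^sup>2 \<noteq> 0" for x :: real
    by (smt (verit) zero_le_power2)
  let ?f = "\<lambda>t::real. arctan t - (t - t^3/3 + t^5/5 - t^7/7 + t^9/9 - t^11/11)"
  have "(?f has_real_derivative x^12 / (1 + x\<^sup>2)) (at x)" for x
    by (rule derivative_eq_intros refl | simp add: nz)+ (simp add: nz divide_simps, algebra?)
  then have "?f 0 \<le> ?f t"
    using assms by (intro DERIV_nonneg_imp_nondecreasing[of 0 t ?f]) (auto intro!: exI divide_nonneg_nonneg)
  then show "t - t^3/3 + t^5/5 - t^7/7 + t^9/9 - t^11/11 \<le> arctan t" by simp
  let ?g = "\<lambda>t::real. (t - t^3/3 + t^5/5 - t^7/7 + t^9/9) - arctan t"
  have "(?g has_real_derivative x^10 / (1 + x\<^sup>2)) (at x)" for x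
    by (rule derivative_eq_intros refl | simp add: nz)+ (simp add: nz divide_simps, algebra?)
  then have "?g 0 \<le> ?g t"
    using assms by (intro DERIV_nonneg_imp_nondecreasing[of 0 t ?g]) (auto intro!: exI divide_nonneg_nonneg)
  then show "arctan t \<le> t - t^3/3 + t^5/5 - t^7/7 + t^9/9" by simp
qed

text \<open>Machin's formula \<open>pi / 4 = 4 * arctan (1 / 5) - arctan (1 / 239)\<close> with the
  Taylor bounds.\<close>

lemma pi_bounds: "3.1415926 < pi" "pi < 3.1415927"
  using arctan_taylor_bounds[of "1/5"] arctan_taylor_bounds[of "1/239"] machin
  by (simp_all add: field_simps)

text \<open>Inserting the closed forms of the tail moments into the optimality condition for the
  two-tailed design gives this expression up to a positive constant; see
  \<open>crit_eq_moments\<close>.\<close>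

definition crit :: "real \<Rightarrow> real" where
  "crit y = (9 - 3 * cos y) * y\<^sup>2 - sin y * (4 - 6 * cos y + 14 * (cos y)\<^sup>2) * y
     - (sin y)\<^sup>2 * (16 - 20 * cos y - (cos y)\<^sup>2 - (cos y)^3)"

lemma crit_has_derivative:
  "(crit has_real_derivative
     sin y * (3 * y\<^sup>2 - (1 - cos y) * (24 + 52 * cos y + 9 * (cos y)\<^sup>2 + 5 * (cos y)^3))
       + (1 - cos y) * (42 * (cos y)\<^sup>2 + 30 * cos y + 12) * y) (at y)"
proof -
  have sc: "(sin y)\<^sup>2 + (cos y)\<^sup>2 = 1" by simp
  show ?thesis
    unfolding crit_def[abs_def]
    by (rule derivative_eq_intros refl)+ (simp, insert sc, algebra)
qed

text \<open>For fixed \<open>cos y\<close>, \<open>crit y / (sin y)\<^sup>2\<close> is a convex quadratic in \<open>q = y / sin y\<close>. It is negative at \<open>q = 1\<close>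
  and at the upper bound for \<open>q\<close> that the Pade bound for \<open>arctan\<close> provides.\<close>

lemma crit_neg:
  assumes "0 < y" "y < pi" "1 / 8 \<le> cos y"
  shows "crit y < 0"
proof -
  define t where "t = tan (y / 2)"
  have c2: "0 < cos (y / 2)" and s2: "0 < sin (y / 2)"
    using assms by (auto intro!: cos_gt_zero sin_gt_zero)
  have t: "0 < t" using c2 s2 by (simp add: t_def tan_def)
  have y: "y = 2 * arctan t" using assms by (simp add: t_def arctan_tan)
  have d: "0 < 1 + t\<^sup>2" by (simp add: add_pos_nonneg)
  have t_c2: "t * cos (y / 2) = sin (y / 2)" using c2 by (simp add: t_def tan_def)
  have "(1 + t\<^sup>2) * (cos (y / 2))\<^sup>2 = 1"
    using sin_cos_squared_add[of "y / 2"] unfolding t_c2[symmetric]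
    by (simp add: power_mult_distrib algebra_simps)
  then have c2sq: "(cos (y / 2))\<^sup>2 = 1 / (1 + t\<^sup>2)" using d by (simp add: field_simps)
  have "cos y = 2 * (cos (y / 2))\<^sup>2 - 1" using cos_double_cos[of "y / 2"] by simp
  then have cos: "cos y = (1 - t\<^sup>2) / (1 + t\<^sup>2)" using d unfolding c2sq by (simp add: field_simps)
  have "sin y = 2 * t * (cos (y / 2))\<^sup>2"
    using sin_double[of "y / 2"] t_c2 by (simp add: power2_eq_square)
  then have s: "sin y = 2 * t / (1 + t\<^sup>2)" unfolding c2sq by simp
  \<comment> \<open>By the half-angle formulas, \<open>1 / 8 \<le> cos y\<close> becomes
    \<open>\<tau> \<le> 7 / 9\<close>.\<close>
  define \<tau> where "\<tau> = t\<^sup>2"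
  have \<tau>: "0 < \<tau>" "\<tau> \<le> 7 / 9"
    using t assms(3) d unfolding cos \<tau>_def by (auto simp: field_simps)
  \<comment> \<open>Chosen so that \<open>U * sin y\<close> is the Pade bound for
    \<open>y = 2 * arctan t\<close>.\<close>
  define U where "U = (1 + \<tau>) * (15 + 4 * \<tau>) / (15 + 9 * \<tau>)"
  define q where "q = y / sin y"
  have sy: "0 < sin y" using assms by (simp add: sin_gt_zero)
  have q1: "1 < q"
  proof -
    have "sin y = 2 * sin (y / 2) * cos (y / 2)" using sin_double[of "y / 2"] by simp
    also have "\<dots> < 2 * sin (y / 2) * 1"
      using s2 cos_monotone_0_pi[of 0 "y / 2"] assms by (intro mult_strict_left_mono) auto
    also have "\<dots> \<le> y" using sin_x_le_x[of "y / 2"] assms by simp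
    finally show ?thesis using sy by (simp add: q_def)
  qed
  have "y < 2 * (t * (15 + 4 * \<tau>) / (15 + 9 * \<tau>))"
    using arctan_less_pade[OF t] by (simp add: y \<tau>_def)
  also have "\<dots> = U * sin y"
  proof -
    have "15 + 9 * t\<^sup>2 \<noteq> 0" using zero_le_power2[of t] by linarith
    then show ?thesis using d unfolding s U_def \<tau>_def by (simp add: divide_simps)
  qed
  finally have qU: "q < U" using sy by (simp add: q_def field_simps)
  define c where "c = cos y"
  define A where "A = 9 - 3 * c"
  define B where "B = 4 - 6 * c + 14 * c\<^sup>2"
  define C where "C = 16 - 20 * c - c\<^sup>2 - c ^ 3"
  have c_eq: "c = (1 - \<tau>) / (1 + \<tau>)" using cos by (simp add: c_def \<tau>_def)
  have cl: "c < 1" using \<tau> by (simp add: c_eq field_simps)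
  have E1: "A - B - C < 0"
  proof -
    have "A - B - C = - ((1 - c)\<^sup>2 * (11 - c))" unfolding A_def B_def C_def by algebra
    then show ?thesis using cl by simp
  qed
  have EU: "A * U\<^sup>2 - B * U - C < 0"
  proof -
    let ?P = "1 + \<tau>" and ?W = "15 + 9 * \<tau>"
    have P: "0 < ?P" "0 < ?W" using \<tau> by auto
    \<comment> \<open>The relations \<open>cP\<close> and \<open>UW\<close> clear all denominators
      and leave a polynomial in \<open>\<tau>\<close>.\<close>
    have cP: "c * ?P = 1 - \<tau>" using P by (simp add: c_eq)
    have UW: "U * ?W = ?P * (15 + 4 * \<tau>)" using P by (simp add: U_def)
    have "(A * U\<^sup>2 - B * U - C) * (?P ^ 3 * ?W\<^sup>2)
        = \<tau> ^ 3 * (192 * \<tau> ^ 4 + 1440 * \<tau> ^ 3 + 2112 * \<tau>\<^sup>2 - 768 * \<tau> - 1920)"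
    proof -
      have "A * ?P = 6 + 12 * \<tau>" unfolding A_def using cP by algebra
      moreover have "B * ?P\<^sup>2 = 12 - 20 * \<tau> + 24 * \<tau>\<^sup>2" unfolding B_def using cP by algebra
      moreover have "C * ?P ^ 3 = - 6 + 32 * \<tau> + 66 * \<tau>\<^sup>2 + 36 * \<tau> ^ 3" unfolding C_def using cP by algebra
      moreover have "(A * U\<^sup>2 - B * U - C) * (?P ^ 3 * ?W\<^sup>2)
         = (A * ?P) * ?P\<^sup>2 * (U * ?W)\<^sup>2 - (B * ?P\<^sup>2) * ?P * (U * ?W) * ?W - (C * ?P ^ 3) * ?W\<^sup>2"
        by algebra
      ultimately show ?thesis unfolding UW by algebra
    qed
    moreover have "192 * \<tau> ^ 4 + 1440 * \<tau> ^ 3 + 2112 * \<tau>\<^sup>2 - 768 * \<tau> - 1920 < 0"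
    proof -
      have 1: "\<tau>\<^sup>2 \<le> 7 / 9 * \<tau>" using \<tau> by (simp add: power2_eq_square)
      have 2: "\<tau> ^ 3 \<le> 7 / 9 * \<tau>\<^sup>2" using \<tau> by (simp add: power2_eq_square power3_eq_cube)
      have 3: "\<tau> ^ 4 \<le> 7 / 9 * \<tau> ^ 3" using \<tau> by (simp add: power4_eq_xxxx power3_eq_cube)
      show ?thesis using 1 2 3 \<tau> by (simp add: field_simps)
    qed
    ultimately have "(A * U\<^sup>2 - B * U - C) * (?P ^ 3 * ?W\<^sup>2) < 0"
      using \<tau> by (simp add: mult_pos_neg)
    then show ?thesis using P by (simp add: mult_less_0_iff)
  qed
  \<comment> \<open>Interpolation of the quadratic between 1 and \<open>U\<close>; the last term is
    the convexity defect, nonnegative because \<open>A > 0\<close>.\<close>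
  have "(A * q\<^sup>2 - B * q - C) * (U - 1) = (A - B - C) * (U - q) + (A * U\<^sup>2 - B * U - C) * (q - 1)
      - A * (q - 1) * (U - q) * (U - 1)" by algebra
  moreover have "\<dots> < 0"
  proof -
    have "(A - B - C) * (U - q) < 0" using E1 qU by (simp add: mult_neg_pos)
    moreover have "(A * U\<^sup>2 - B * U - C) * (q - 1) < 0" using EU q1 by (simp add: mult_neg_pos)
    moreover have "0 \<le> A * (q - 1) * (U - q) * (U - 1)"
      using cl q1 qU by (simp add: A_def)
    ultimately show ?thesis by linarith
  qed
  ultimately have "(A * q\<^sup>2 - B * q - C) * (U - 1) < 0" by (simp only:)
  then have "A * q\<^sup>2 - B * q - C < 0" using q1 qU mult_nonneg_nonneg[of "A * q\<^sup>2 - B * q - C" "U - 1"] by linarith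
  moreover have "crit y = (sin y)\<^sup>2 * (A * q\<^sup>2 - B * q - C)"
    using sy unfolding crit_def q_def A_def B_def C_def c_def
    by (simp add: field_simps power2_eq_square)
  ultimately show ?thesis using sy by (simp add: mult_pos_neg)
qed

text \<open>Since \<open>sin y \<le> 1\<close>, the positive second summand is at least
  \<open>sin y\<close> times itself. This leaves \<open>sin y\<close> times a factor that, for fixed
  \<open>c = cos y\<close>, increases with \<open>y > 0\<close>. There \<open>y\<close> is replaced
  by a lower bound \<open>l\<close> depending on \<open>c\<close> alone:
  \<open>157 / 100 < pi / 2\<close> for \<open>c \<le> 0\<close>, and
  \<open>157 / 100 - c / 0.99\<close> for \<open>0 < c \<le> 1 / 8\<close>.\<close>

lemma crit_deriv_pos:
  assumes "0 < y" "y < pi" "cos y \<le> 1 / 8"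
  shows "0 < sin y * (3 * y\<^sup>2 - (1 - cos y) * (24 + 52 * cos y + 9 * (cos y)\<^sup>2 + 5 * (cos y)^3))
       + (1 - cos y) * (42 * (cos y)\<^sup>2 + 30 * cos y + 12) * y"
proof -
  define c where "c = cos y"
  have sy: "0 < sin y" using assms by (simp add: sin_gt_zero)
  have c1: "- 1 \<le> c" by (simp add: c_def)
  have c8: "c \<le> 1 / 8" using assms by (simp add: c_def)
  have Q: "0 < 42 * c\<^sup>2 + 30 * c + 12"
  proof -
    have "42 * c\<^sup>2 + 30 * c + 12 = 42 * (c + 5 / 14)\<^sup>2 + 93 / 14" by (simp add: power2_eq_square algebra_simps)
    then show ?thesis by (simp add: add_nonneg_pos)
  qed
  have main: "0 < 3 * l\<^sup>2 + (1 - c) * ((42 * c\<^sup>2 + 30 * c + 12) * l - (24 + 52 * c + 9 * c\<^sup>2 + 5 * c ^ 3))"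
    if "l = (if c \<le> 0 then 157 / 100 else 157 / 100 - 100 * c / 99)" for l
  proof (cases "c \<le> 0")
    case True
    define v where "v = - c"
    have v: "0 \<le> v" "v \<le> 1" using True c1 by (auto simp: v_def)
    have "3 * l\<^sup>2 + (1 - c) * ((42 * c\<^sup>2 + 30 * c + 12) * l - (24 + 52 * c + 9 * c\<^sup>2 + 5 * c ^ 3))
      = 22347 / 10000 + 1546 / 25 * v\<^sup>2 + 3097 / 50 * v ^ 3 + 5 * v ^ 4 - 13 / 50 * v"
      using True unfolding that v_def by simp algebra
    moreover have "0 \<le> v ^ 3" "0 \<le> v ^ 4" "0 \<le> v\<^sup>2" using v by auto
    ultimately show ?thesis using v by linarith
  next
    case False
    then have c: "0 < c" by simp
    have "3 * l\<^sup>2 + (1 - c) * ((42 * c\<^sup>2 + 30 * c + 12) * l - (24 + 52 * c + 9 * c\<^sup>2 + 5 * c ^ 3))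
      = 22347 / 10000 - 11757 / 550 * c + 3815782 / 81675 * c\<^sup>2 - 122201 / 1650 * c ^ 3 + 1565 / 33 * c ^ 4"
      using False unfolding that by simp algebra
    moreover have "c ^ 3 \<le> c\<^sup>2 / 8" using c c8 by (simp add: power2_eq_square power3_eq_cube)
    \<comment> \<open>The tangent of the square at the endpoint \<open>1 / 8\<close> reduces the
      claim to a linear inequality in \<open>c\<close>.\<close>
    moreover have "c / 4 - 1 / 64 \<le> c\<^sup>2"
      using zero_le_power2[of "c - 1 / 8"] by (simp add: power2_eq_square algebra_simps)
    moreover have "0 \<le> c ^ 4" by simp
    ultimately show ?thesis using c c8 by linarith
  qed
  have l: "l \<le> y" if "l = (if c \<le> 0 then 157 / 100 else 157 / 100 - 100 * c / 99)" for l
  proof (cases "c \<le> 0")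
    case True
    then have "pi / 2 \<le> y"
      using cos_gt_zero[of y] assms(1) by (force simp: c_def)
    then show ?thesis using True that pi_bounds by simp
  next
    case False
    \<comment> \<open>For the complementary angle,
      \<open>z < tan z = c / sin y \<le> c / 0.99\<close>.\<close>
    define z where "z = pi / 2 - y"
    have "y < pi / 2"
      using False cos_monotone_0_pi_le[of "pi / 2" y] assms(2) by (force simp: c_def)
    then have z: "0 < z" "z < pi / 2" using assms by (auto simp: z_def)
    have cz: "sin z = c" "cos z = sin y"
      by (auto simp: z_def c_def sin_diff cos_diff)
    have "0.99 \<le> sin y"
    proof (rule power2_le_imp_le)
      have "c\<^sup>2 \<le> (1 / 8)\<^sup>2" using False c8 by (intro power_mono) auto
      then show "0.99\<^sup>2 \<le> (sin y)\<^sup>2"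
        using sin_cos_squared_add[of y] by (simp add: c_def power2_eq_square)
    qed (use sy in simp)
    then have "tan z \<le> c / 0.99"
      unfolding tan_def cz using False by (intro divide_left_mono) auto
    moreover have "z < tan z"
      using arctan_less_self[of "tan z"] z tan_gt_zero[of z] by (simp add: arctan_tan)
    ultimately show ?thesis using False that pi_bounds by (simp add: z_def)
  qed
  define l where "l = (if c \<le> 0 then 157 / 100 else 157 / 100 - 100 * c / 99 :: real)"
  have l0: "0 < l" using c8 by (simp add: l_def)
  have "0 < 3 * l\<^sup>2 + (1 - c) * ((42 * c\<^sup>2 + 30 * c + 12) * l - (24 + 52 * c + 9 * c\<^sup>2 + 5 * c ^ 3))"
    using main l_def by blast
  also have "\<dots> \<le> 3 * y\<^sup>2 + (1 - c) * ((42 * c\<^sup>2 + 30 * c + 12) * y - (24 + 52 * c + 9 * c\<^sup>2 + 5 * c ^ 3))"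
  proof -
    have "l\<^sup>2 \<le> y\<^sup>2" using l[OF l_def] l0 by (intro power_mono) auto
    moreover have "(42 * c\<^sup>2 + 30 * c + 12) * l \<le> (42 * c\<^sup>2 + 30 * c + 12) * y"
      using l[OF l_def] Q by (intro mult_left_mono) auto
    ultimately show ?thesis using c8 by (intro add_mono[OF mult_left_mono mult_left_mono] diff_right_mono) auto
  qed
  finally have "0 < sin y * \<dots>" using sy by simp
  also have "\<dots> \<le> sin y * (3 * y\<^sup>2 - (1 - c) * (24 + 52 * c + 9 * c\<^sup>2 + 5 * c ^ 3))
       + (1 - c) * (42 * c\<^sup>2 + 30 * c + 12) * y"
  proof -
    have "sin y * ((1 - c) * (42 * c\<^sup>2 + 30 * c + 12) * y) \<le> 1 * ((1 - c) * (42 * c\<^sup>2 + 30 * c + 12) * y)"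
      using c8 Q assms by (intro mult_right_mono) auto
    then show ?thesis by (simp add: algebra_simps)
  qed
  finally show ?thesis by (simp add: c_def)
qed

text \<open>Up to \<open>ym = arccos (1 / 8)\<close> the function is negative by
  \<open>crit_neg\<close>; from there to \<open>pi\<close> it is strictly increasing and ends
  positive, so it has exactly one zero.\<close>

lemma crit_sign:
  obtains ys where "0 < ys" "ys < pi" "\<And>y. 0 < y \<Longrightarrow> y < pi \<Longrightarrow> crit y < 0 \<longleftrightarrow> y < ys"
proof -
  define ym :: real where "ym = arccos (1 / 8)"
  have ym: "0 < ym" "ym < pi" "cos ym = 1 / 8"
    using arccos_lt_bounded[of "1 / 8"] by (auto simp: ym_def)
  have le_ym: "1 / 8 \<le> cos y \<longleftrightarrow> y \<le> ym" if "0 < y" "y < pi" for y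
    using cos_mono_le_eq[of ym y] that ym by auto
  have mono: "crit x < crit y" if "ym \<le> x" "x < y" "y \<le> pi" for x y
  proof (rule DERIV_pos_imp_increasing_open[OF that(2)])
    fix z assume z: "x < z" "z < y"
    then have "cos z \<le> 1 / 8" using le_ym[of z] that ym by auto
    then show "\<exists>d. (crit has_real_derivative d) (at z) \<and> 0 < d"
      using crit_has_derivative[of z] crit_deriv_pos[of z] z that ym by auto
  qed (unfold crit_def[abs_def], intro continuous_intros)
  have cont: "continuous_on A crit" for A
    unfolding crit_def[abs_def] by (intro continuous_intros)
  have "crit ym < 0" using crit_neg[of ym] ym by simp
  moreover have "0 < crit pi" by (simp add: crit_def)
  ultimately obtain ys where ys: "ym \<le> ys" "ys \<le> pi" "crit ys = 0"
    using IVT'[of crit ym 0 pi] ym cont by auto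
  show thesis
  proof
    show "0 < ys" using ys ym by simp
    show "ys < pi" using ys \<open>0 < crit pi\<close> by (cases "ys = pi") auto
    fix y assume y: "0 < y" "y < pi"
    show "crit y < 0 \<longleftrightarrow> y < ys"
    proof (cases "y \<le> ym")
      case True
      then have "crit y < 0" using crit_neg[of y] le_ym[of y] y by simp
      then show ?thesis using True ys \<open>crit ym < 0\<close> by (cases "ys = ym") auto
    next
      case False
      then show ?thesis using mono[of y ys] mono[of ys y] ys y by (cases y ys rule: linorder_cases) auto
    qed
  qed
qed

text \<open>The integral of \<open>x ^ (2 * j)\<close> against the density over \<open>\<bar>x\<bar> \<ge> a\<close>, where \<open>a = sqrt 5 * cot (y / 2)\<close>.\<close>

definition tail_moment :: "nat \<Rightarrow> real \<Rightarrow> real" where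
  "tail_moment j y = 5 ^ j * ((if j = 1 then 2 else 6) * y + 8 * (real j - 1) * sin y + (- 1) ^ j * sin (2 * y))
     / (6 * pi)"

section \<open>Numerical location of the sign change\<close>

lemma sin_cos_double_arctan:
  "sin (2 * arctan e) = 2 * e / (1 + e\<^sup>2)" "cos (2 * arctan e) = (1 - e\<^sup>2) / (1 + e\<^sup>2)"
proof -
  have d: "0 < 1 + e\<^sup>2" by (simp add: add_pos_nonneg)
  then have sq: "sqrt (1 + e\<^sup>2) * sqrt (1 + e\<^sup>2) = 1 + e\<^sup>2" by simp
  show "sin (2 * arctan e) = 2 * e / (1 + e\<^sup>2)"
    unfolding sin_double sin_arctan cos_arctan using sq by simp
  show "cos (2 * arctan e) = (1 - e\<^sup>2) / (1 + e\<^sup>2)"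
    unfolding cos_double sin_arctan cos_arctan using d
    by (simp add: power_divide diff_divide_distrib)
qed

lemma half_pi_plus:
  fixes e y
  defines "y \<equiv> pi / 2 + 2 * arctan e"
  shows "sin y = (1 - e\<^sup>2) / (1 + e\<^sup>2)" "cos y = - (2 * e / (1 + e\<^sup>2))"
  unfolding y_def sin_add cos_add sin_cos_double_arctan by simp_all

text \<open>The sign change is at \<open>pi / 2 + 2 * arctan e\<close> with \<open>e = 0.014830176\<close> approximately; at a rational argument of \<open>arctan\<close> the sine and the cosine
  of the angle are rational, so that only \<open>pi\<close> and \<open>arctan\<close> have to be bounded.\<close>

lemma crit_bracket:
  defines "y1 \<equiv> pi / 2 + 2 * arctan 0.01482" and "y2 \<equiv> pi / 2 + 2 * arctan 0.0148312"
  shows "crit y1 < 0" "0 < crit y2" "0.08206 < tail_moment 0 y1" "tail_moment 0 y2 < 0.08207"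
proof -
  have y1: "1.60043413 < y1" "y1 < 1.60043419"
    using arctan_taylor_bounds[of "0.01482"] pi_bounds unfolding y1_def by (simp_all add: field_simps)
  have y2: "1.60045652 < y2" "y2 < 1.60045658"
    using arctan_taylor_bounds[of "0.0148312"] pi_bounds unfolding y2_def by (simp_all add: field_simps)
  note trig1 = half_pi_plus[of "0.01482", folded y1_def] and trig2 = half_pi_plus[of "0.0148312", folded y2_def]
  \<comment> \<open>The coefficients are rational at this angle and are rounded so that the
    expression grows. The resulting quadratic is increasing near \<open>y1\<close>, so its value at
    the upper bound for \<open>y1\<close> suffices.\<close>
  have "crit y1 \<le> 9.08890049 * y1\<^sup>2 - 4.18825479 * y1 - 16.5772477"
    unfolding crit_def trig1
  proof (intro diff_mono mult_right_mono)
  qed (use y1 in \<open>simp_all add: field_simps\<close>)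
  also have "\<dots> = 9.08890049 * 1.60043419\<^sup>2 - 4.18825479 * 1.60043419 - 16.5772477
      - (1.60043419 - y1) * (9.08890049 * (1.60043419 + y1) - 4.18825479)"
    by (simp add: field_simps power2_eq_square)
  also have "\<dots> \<le> 9.08890049 * 1.60043419\<^sup>2 - 4.18825479 * 1.60043419 - 16.5772477"
    using y1 by simp
  also have "\<dots> < 0" by (simp add: power2_eq_square)
  finally show "crit y1 < 0" .
  \<comment> \<open>The same with opposite rounding, evaluated at the lower bound for
    \<open>y2\<close>.\<close>
  have "0 < 9.08896763 * 1.60045652\<^sup>2 - 4.18840485 * 1.60045652 - (16.57767174 :: real)"
    by (simp add: power2_eq_square)
  also have "\<dots> \<le> 9.08896763 * 1.60045652\<^sup>2 - 4.18840485 * 1.60045652 - 16.57767174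
      + (y2 - 1.60045652) * (9.08896763 * (1.60045652 + y2) - 4.18840485)"
    using y2 by simp
  also have "\<dots> = 9.08896763 * y2\<^sup>2 - 4.18840485 * y2 - 16.57767174"
    by (simp add: field_simps power2_eq_square)
  also have "\<dots> \<le> crit y2"
    unfolding crit_def trig2
  proof (intro diff_mono mult_right_mono)
  qed (use y2 in \<open>simp_all add: field_simps\<close>)
  finally show "0 < crit y2" .
  have "0.08206 * (6 * pi) < 6 * y1 - 8 * sin y1 + sin (2 * y1)"
    unfolding sin_double trig1 using y1 pi_bounds by (simp add: power2_eq_square)
  then show "0.08206 < tail_moment 0 y1"
    unfolding tail_moment_def by (subst pos_less_divide_eq) auto
  have "6 * y2 - 8 * sin y2 + sin (2 * y2) < 0.08207 * (6 * pi)"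
    unfolding sin_double trig2 using y2 pi_bounds by (simp add: power2_eq_square)
  then show "tail_moment 0 y2 < 0.08207"
    unfolding tail_moment_def by (subst pos_divide_less_eq) auto
qed

section \<open>The t-distribution with five degrees of freedom\<close>

text \<open>The inverse of \<open>x = sqrt 5 * cot (y / 2)\<close>, written with
  \<open>arctan\<close> so that it is smooth on the whole line: \<open>x \<ge> 0\<close> corresponds
  to angles in \<open>(0, pi]\<close>, negative \<open>x\<close> to angles in
  \<open>(pi, 2 * pi)\<close>.\<close>

abbreviation angle :: "real \<Rightarrow> real" where
  "angle x \<equiv> pi - 2 * arctan (x / sqrt 5)"

abbreviation tails :: "real \<Rightarrow> real set" where
  "tails a \<equiv> {..- a} \<union> {a..}"

section \<open>The density and its tail integrals\<close>

lemma student_t_density_5: "student_t_density 5 x = 8 / (3 * pi * sqrt 5) / (1 + x\<^sup>2 / 5) ^ 3"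
proof -
  have "Gamma (3 :: real) = 2" using Gamma_fact[of 2, where 'a = real] by simp
  moreover have "Gamma (5 / 2 :: real) = 3 / 4 * sqrt pi"
  proof -
    have "(1 / 2 :: real) \<notin> \<int>\<^sub>\<le>\<^sub>0" "(3 / 2 :: real) \<notin> \<int>\<^sub>\<le>\<^sub>0"
      by (auto dest: nonpos_Ints_nonpos)
    then show ?thesis
      using Gamma_plus1[of "3 / 2 :: real"] Gamma_plus1[of "1 / 2 :: real"] Gamma_one_half_real by simp
  qed
  moreover have "(1 + x\<^sup>2 / 5) powr (- 3) = 1 / (1 + x\<^sup>2 / 5) ^ 3"
  proof -
    have "0 < 1 + x\<^sup>2 / 5" by (simp add: add_pos_nonneg)
    then show ?thesis unfolding powr_minus by (simp only: powr_numeral divide_inverse mult_1)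
  qed
  moreover have "(5 + 1) / 2 = (3 :: real)" by simp
  moreover have "sqrt (5 * pi) * (3 / 4 * sqrt pi) = 3 / 4 * pi * sqrt 5"
    by (simp add: real_sqrt_mult)
  ultimately have "student_t_density 5 x = 2 / (3 / 4 * pi * sqrt 5) * (1 / (1 + x\<^sup>2 / 5) ^ 3)"
    unfolding student_t_density_def by (simp only:)
  then show ?thesis by simp
qed

text \<open>Under the substitution, \<open>x^2 = 5 * (1 + cos y) / (1 - cos y)\<close> and
  \<open>1 + x^2 / 5 = 2 / (1 - cos y)\<close>, so the right-hand side is the transformed integrand,
  doubled for the two tails.\<close>

lemma tail_moment_has_derivative:
  assumes "j \<le> 2"
  shows "(tail_moment j has_real_derivative 2 / (3 * pi) * (1 - cos y) ^ (2 - j) * (5 * (1 + cos y)) ^ j) (at y)"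
proof -
  have *: "(tail_moment j has_real_derivative
    5 ^ j * ((if j = 1 then 2 else 6) + 8 * (real j - 1) * cos y + (- 1) ^ j * (2 * cos (2 * y))) / (6 * pi)) (at y)"
    unfolding tail_moment_def[abs_def] by (auto intro!: derivative_eq_intros simp: divide_simps)
  have j: "j = 0 \<or> j = 1 \<or> j = 2" using assms by auto
  have "5 ^ j * ((if j = 1 then 2 else 6) + 8 * (real j - 1) * c + (- 1) ^ j * (2 * (2 * c\<^sup>2 - 1))) / (6 * pi)
      = 2 / (3 * pi) * (1 - c) ^ (2 - j) * (5 * (1 + c)) ^ j" for c
    using j by (elim disjE) (simp_all add: field_simps power2_eq_square)
  then show ?thesis using * by (simp only: cos_double_cos)
qed

lemma cos_less_one: "0 < y \<Longrightarrow> y < 2 * pi \<Longrightarrow> cos y < 1"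
proof -
  assume "0 < y" "y < 2 * pi"
  then have "0 < sin (y / 2)" by (intro sin_gt_zero) auto
  then have "0 < (sin (y / 2))\<^sup>2" by simp
  then show ?thesis using cos_double_sin[of "y / 2"] by simp
qed

text \<open>For \<open>j = 0\<close> the derivative is positive on all of
  \<open>(0, 2 * pi)\<close>, and this range is needed for quantiles of either sign; for larger
  \<open>j\<close> it vanishes at \<open>pi\<close>.\<close>

lemma tail_moment_less:
  assumes "j \<le> 2" "0 \<le> x" "x < y" "y \<le> (if j = 0 then 2 * pi else pi)"
  shows "tail_moment j x < tail_moment j y"
proof (rule DERIV_pos_imp_increasing_open[OF assms(3)])
  fix z assume z: "x < z" "z < y"
  then have "cos z < 1" using assms by (intro cos_less_one) (auto split: if_splits)
  moreover have "- 1 < cos z" if "j \<noteq> 0"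
    using cos_monotone_0_pi[of z pi] z assms that by simp
  ultimately have "0 < 2 / (3 * pi) * (1 - cos z) ^ (2 - j) * (5 * (1 + cos z)) ^ j"
    by (cases "j = 0") auto
  then show "\<exists>d. (tail_moment j has_real_derivative d) (at z) \<and> 0 < d"
    using tail_moment_has_derivative[OF assms(1)] by blast
qed (unfold tail_moment_def[abs_def], intro continuous_intros, simp)

lemma tail_moment_0 [simp]: "tail_moment j 0 = 0"
  by (simp add: tail_moment_def)

text \<open>The reflection \<open>y \<mapsto> 2 * pi - y\<close> of angles corresponds to
  \<open>x \<mapsto> - x\<close>.\<close>

lemma tail_moment_reflect: "tail_moment 0 (2 * pi - y) = 2 - tail_moment 0 y"
  unfolding tail_moment_def sin_double sin_2pi_minus cos_2pi_minus by (simp add: field_simps)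

text \<open>An antiderivative is \<open>- tail_moment j (angle x) / 2\<close>, which tends to 0 at
  infinity because the angle does. The endpoint \<open>a\<close> may be negative, as the
  distribution function requires.\<close>

lemma nn_integral_upper_tail:
  assumes "j \<le> 2"
  shows "(\<integral>\<^sup>+x. ennreal (x ^ (2 * j) * student_t_density 5 x) * indicator {a..} x \<partial>lborel)
    = ennreal (tail_moment j (angle a) / 2)"
proof -
  have "(\<integral>\<^sup>+x. ennreal (x ^ (2 * j) * student_t_density 5 x) * indicator {a..} x \<partial>lborel)
    = ennreal (0 - - tail_moment j (angle a) / 2)"
  proof (rule nn_integral_FTC_atLeast)
    show "(\<lambda>x. x ^ (2 * j) * student_t_density 5 x) \<in> borel_measurable borel"
      unfolding student_t_density_5 by measurable
    show "0 \<le> x ^ (2 * j) * student_t_density 5 x" for x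
      unfolding student_t_density_5 power_mult by (intro mult_nonneg_nonneg divide_nonneg_nonneg) auto
    have "((\<lambda>x. arctan (x / sqrt 5)) \<longlongrightarrow> pi / 2) at_top"
      by (intro filterlim_compose[OF tendsto_arctan_at_top]) real_asymp
    then have "((\<lambda>x. angle x) \<longlongrightarrow> pi - 2 * (pi / 2)) at_top"
      by (intro tendsto_intros)
    moreover have "isCont (tail_moment j) 0"
      using tail_moment_has_derivative[OF assms] by (rule DERIV_isCont)
    ultimately have "((\<lambda>x. tail_moment j (angle x)) \<longlongrightarrow> tail_moment j 0) at_top"
      by (intro isCont_tendsto_compose[of 0 "tail_moment j"]) auto
    then show "((\<lambda>x. - tail_moment j (angle x) / 2) \<longlongrightarrow> 0) at_top"
      by (auto intro!: tendsto_eq_intros)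
    fix x :: real
    let ?u = "x / sqrt 5" and ?t = "1 + x\<^sup>2 / 5"
    have t: "0 < ?t" by (simp add: add_pos_nonneg)
    have u2: "?u\<^sup>2 = x\<^sup>2 / 5" by (simp add: power_divide)
    have c: "cos (angle x) = - ((1 - x\<^sup>2 / 5) / ?t)"
      unfolding cos_diff sin_cos_double_arctan u2 by (simp only: cos_pi sin_pi mult_zero_left mult_minus1 add_0_right)
    have c1: "1 - cos (angle x) = 2 / ?t" "5 * (1 + cos (angle x)) = 2 * x\<^sup>2 / ?t"
      unfolding c using t by (auto simp: field_simps)
    have "((\<lambda>x. arctan (x / sqrt 5)) has_real_derivative inverse (1 + ?u\<^sup>2) * (1 / sqrt 5)) (at x)"
      by (rule DERIV_chain2[OF DERIV_arctan]) (auto intro!: derivative_eq_intros simp: real_div_sqrt)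
    then have "((\<lambda>x. angle x) has_real_derivative 0 - 2 * (inverse (1 + ?u\<^sup>2) * (1 / sqrt 5))) (at x)"
      by (intro DERIV_diff DERIV_const DERIV_cmult)
    moreover have "0 - 2 * (inverse (1 + ?u\<^sup>2) * (1 / sqrt 5)) = - 2 / (sqrt 5 * ?t)"
      unfolding u2 by (simp only: divide_inverse inverse_mult_distrib) simp
    ultimately have "((\<lambda>x. angle x) has_real_derivative - 2 / (sqrt 5 * ?t)) (at x)" by (simp only:)
    from DERIV_chain2[OF tail_moment_has_derivative[OF assms] this]
    have "((\<lambda>x. tail_moment j (angle x)) has_real_derivative
       2 / (3 * pi) * (2 / ?t) ^ (2 - j) * (2 * x\<^sup>2 / ?t) ^ j * (- 2 / (sqrt 5 * ?t))) (at x)"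
      unfolding c1 .
    note this[THEN DERIV_minus, THEN DERIV_cdivide, of 2]
    moreover have "j = 0 \<or> j = 1 \<or> j = 2" using assms by auto
    then have "- (2 / (3 * pi) * (2 / ?t) ^ (2 - j) * (2 * x\<^sup>2 / ?t) ^ j * (- 2 / (sqrt 5 * ?t))) / 2
       = x ^ (2 * j) * student_t_density 5 x"
      unfolding student_t_density_5 using t
      by (elim disjE) (simp_all add: divide_simps power2_eq_square power3_eq_cube power4_eq_xxxx)
    ultimately show "((\<lambda>x. - tail_moment j (angle x) / 2) has_real_derivative x ^ (2 * j) * student_t_density 5 x) (at x)"
      by (simp only:)
  qed
  then show ?thesis by simp
qed

lemma has_bochner_integral_tails:
  assumes "j \<le> 2" "0 \<le> a"
  shows "has_bochner_integral lborel (\<lambda>x. x ^ (2 * j) * (student_t_density 5 x * indicator (tails a) x))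
    (tail_moment j (angle a))"
proof -
  let ?h = "\<lambda>x. x ^ (2 * j) * student_t_density 5 x"
  have meas [measurable]: "student_t_density 5 \<in> borel_measurable borel"
    unfolding student_t_density_5[abs_def] by measurable
  have nn: "0 \<le> ?h x" for x
    unfolding student_t_density_5 power_mult by (intro mult_nonneg_nonneg divide_nonneg_nonneg) auto
  have ang: "0 \<le> angle a" "angle a \<le> pi"
    using arctan_ubound[of "a / sqrt 5"] assms(2) by auto
  have pos: "0 \<le> tail_moment j (angle a) / 2"
  proof (cases "angle a = 0")
    case False
    have "angle a \<le> 2 * pi" using ang pi_ge_zero by linarith
    then have "angle a \<le> (if j = 0 then 2 * pi else pi)" using ang by presburger
    then have "tail_moment j 0 < tail_moment j (angle a)" using ang False by (intro tail_moment_less assms(1)) auto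
    then show ?thesis by simp
  qed simp
  have "has_bochner_integral lborel (\<lambda>x. ?h x * indicator {a..} x) (tail_moment j (angle a) / 2)"
    using nn_integral_upper_tail[OF assms(1), of a] nn pos
    by (intro has_bochner_integral_nn_integral)
       (auto simp: ennreal_mult' ennreal_indicator[symmetric] simp del: ennreal_indicator)
  moreover have "?h x * indicator {a..} x
      = indicator {0..} x *\<^sub>R (x ^ (2 * j) * (student_t_density 5 x * indicator (tails a) x))" for x
    using assms(2) by (auto simp: indicator_def)
  ultimately have "has_bochner_integral lborel
      (\<lambda>x. indicator {0..} x *\<^sub>R (x ^ (2 * j) * (student_t_density 5 x * indicator (tails a) x)))
      (tail_moment j (angle a) / 2)" by simp
  from has_bochner_integral_even_function[OF this]
  show ?thesis
    by (auto simp: student_t_density_5 indicator_def)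
qed

text \<open>The centre is the whole line, that is \<open>tails 0\<close>, minus
  \<open>tails b\<close>; only the two points \<open>b\<close> and \<open>- b\<close> are counted
  differently.\<close>

lemma has_bochner_integral_tails_centre:
  assumes "j \<le> 2" "0 \<le> b" "b < a"
  shows "has_bochner_integral lborel
      (\<lambda>x. x ^ (2 * j) * (student_t_density 5 x * indicator ({..- a} \<union> {- b..b} \<union> {a..}) x))
      (tail_moment j (angle a) + (tail_moment j pi - tail_moment j (angle b)))"
proof -
  let ?I = "\<lambda>c x. x ^ (2 * j) * (student_t_density 5 x * indicator (tails c) x)"
  have "has_bochner_integral lborel (\<lambda>x. ?I a x + (?I 0 x - ?I b x))
      (tail_moment j (angle a) + (tail_moment j (angle 0) - tail_moment j (angle b)))"
    using assms by (intro has_bochner_integral_add has_bochner_integral_diff has_bochner_integral_tails) auto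
  then have "has_bochner_integral lborel (\<lambda>x. ?I a x + (?I 0 x - ?I b x))
      (tail_moment j (angle a) + (tail_moment j pi - tail_moment j (angle b)))" by simp
  then show ?thesis
    by (rule has_bochner_integral_discrete_difference[where X = "{b, - b}", THEN iffD1, rotated 4])
       (use assms in \<open>auto simp: indicator_def\<close>)
qed

section \<open>Distribution function, quantiles and thresholds\<close>

lemma cdf_student_t_5: "cdf (student_t 5) x = 1 - tail_moment 0 (angle x) / 2"
proof -
  have meas [measurable]: "student_t_density 5 \<in> borel_measurable borel"
    unfolding student_t_density_5[abs_def] by measurable
  have even: "student_t_density 5 (- x) = student_t_density 5 x" for x
    by (simp add: student_t_density_5)
  have "emeasure (student_t 5) {..x} = (\<integral>\<^sup>+y. ennreal (student_t_density 5 y) * indicator {..x} y \<partial>lborel)"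
    by (simp add: student_t_def emeasure_density)
  \<comment> \<open>Reflection turns the lower tail into an upper tail, for which the integral is
    known.\<close>
  also have "\<dots> = (\<integral>\<^sup>+y. ennreal (student_t_density 5 y) * indicator {- x..} y \<partial>lborel)"
    by (subst nn_integral_real_affine[where c = "- 1" and t = 0])
       (auto simp: even indicator_def intro!: nn_integral_cong)
  also have "\<dots> = ennreal (tail_moment 0 (angle (- x)) / 2)"
    using nn_integral_upper_tail[of 0 "- x"] by simp
  finally have "emeasure (student_t 5) {..x} = \<dots>" .
  moreover have ang: "0 < angle (- x)" "angle (- x) \<le> 2 * pi"
    using arctan_lbound[of "x / sqrt 5"] arctan_ubound[of "x / sqrt 5"] by (simp_all add: arctan_minus)
  moreover have "0 \<le> tail_moment 0 (angle (- x)) / 2"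
    using tail_moment_less[of 0 0 "angle (- x)"] ang by simp
  moreover have "tail_moment 0 (angle (- x)) = 2 - tail_moment 0 (angle x)"
  proof -
    have "angle (- x) = 2 * pi - angle x" by (simp add: arctan_minus)
    then show ?thesis by (simp only: tail_moment_reflect)
  qed
  ultimately show ?thesis
    by (simp add: cdf_def measure_def)
qed

lemma angle_bounds: "0 < angle x" "angle x < 2 * pi"
  using arctan_lbound[of "x / sqrt 5"] arctan_ubound[of "x / sqrt 5"] by simp_all

lemma quantile_student_t_5: "quantile (student_t 5) (1 - tail_moment 0 (angle a) / 2) = a"
proof -
  have "tail_moment 0 (angle x) \<le> tail_moment 0 (angle a) \<longleftrightarrow> a \<le> x" for x
  proof -
    have "angle x < angle y" if "y < x" for x y
      using that by (simp add: arctan_less_iff divide_strict_right_mono)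
    then have less: "tail_moment 0 (angle x) < tail_moment 0 (angle y)" if "y < x" for x y
      using that angle_bounds[of x] angle_bounds[of y] by (intro tail_moment_less) auto
    show ?thesis using less[of a x] less[of x a] by (cases x a rule: linorder_cases) auto
  qed
  then have "{x. 1 - tail_moment 0 (angle a) / 2 \<le> cdf (student_t 5) x} = {a..}"
    by (auto simp: cdf_student_t_5)
  then show ?thesis by (simp add: quantile_def)
qed

text \<open>This is \<open>sqrt 5 * cot (y / 2)\<close>, with the tangent of the complementary angle
  so that \<open>arctan_tan\<close> shows it to be inverse to \<open>angle\<close>.\<close>

definition threshold :: "real \<Rightarrow> real" where
  "threshold y = sqrt 5 * tan ((pi - y) / 2)"

lemma angle_threshold: "0 < y \<Longrightarrow> y < 2 * pi \<Longrightarrow> angle (threshold y) = y"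
proof -
  assume "0 < y" "y < 2 * pi"
  then have "arctan (tan ((pi - y) / 2)) = (pi - y) / 2" by (intro arctan_tan) auto
  then show ?thesis by (simp add: threshold_def field_simps)
qed

lemma threshold_pi [simp]: "threshold pi = 0"
  by (simp add: threshold_def)

lemma threshold_less:
  assumes "0 < x" "x < y" "y \<le> pi"
  shows "threshold y < threshold x"
  unfolding threshold_def using assms by (intro mult_strict_left_mono tan_monotone) auto

text \<open>The half-angle formulas make squared thresholds rational in \<open>cos y\<close>, which
  is how they enter \<open>crit\<close> and the optimality equations.\<close>

lemma threshold_square:
  assumes "0 < y" "y \<le> pi"
  shows "(threshold y)\<^sup>2 * (1 - cos y) = 5 * (1 + cos y)"
proof -
  let ?x = "(pi - y) / 2"
  have "0 < cos ?x" using assms by (intro cos_gt_zero_pi) auto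
  then have "threshold y * cos ?x = sqrt 5 * sin ?x"
    by (simp add: threshold_def tan_def)
  then have "(threshold y)\<^sup>2 * (cos ?x)\<^sup>2 = 5 * (sin ?x)\<^sup>2"
    by (metis power_mult_distrib real_sqrt_pow2 zero_le_numeral)
  moreover have "2 * ?x = pi - y" by (simp add: field_simps)
  then have "cos (2 * ?x) = - cos y" by (simp only: cos_diff) simp
  then have "1 - cos y = 2 * (cos ?x)\<^sup>2" "1 + cos y = 2 * (sin ?x)\<^sup>2"
    using cos_double_cos[of ?x] cos_double_sin[of ?x] by linarith+
  ultimately show ?thesis by simp
qed

text \<open>With \<open>a\<close> the threshold at angle \<open>y\<close>, this identifies the sign of \<open>crit y\<close> with the comparison of the
  sensitivity function of the two-tailed design at \<open>a\<close> and at \<open>0\<close>.\<close>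

lemma crit_eq_moments:
  fixes y :: real
  defines "m \<equiv> \<lambda>j. tail_moment j y"
  shows "5 * (1 + cos y) * m 0 * m 1 + (1 - cos y) * (m 0 * m 2 - 3 * (m 1)\<^sup>2) = 25 / (9 * pi\<^sup>2) * crit y"
proof -
  define s c p where "s = sin y" and "c = cos y" and "p = 6 * pi"
  have sc: "s\<^sup>2 = 1 - c\<^sup>2" by (simp add: s_def c_def sin_squared_eq)
  have p: "p \<noteq> 0" by (simp add: p_def)
  have m: "m 0 * p = 6 * y - 8 * s + 2 * s * c" "m 1 * p = 5 * (2 * y - 2 * s * c)"
    "m 2 * p = 25 * (6 * y + 8 * s + 2 * s * c)"
    using p by (simp_all add: m_def tail_moment_def sin_double s_def c_def p_def)
  have "(5 * (1 + c) * m 0 * m 1 + (1 - c) * (m 0 * m 2 - 3 * (m 1)\<^sup>2)) * p\<^sup>2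
      = 5 * (1 + c) * (m 0 * p) * (m 1 * p) + (1 - c) * ((m 0 * p) * (m 2 * p) - 3 * (m 1 * p)\<^sup>2)"
    by algebra
  also have "\<dots> = 100 * crit y"
    unfolding m crit_def s_def[symmetric] c_def[symmetric] using sc by algebra
  finally show ?thesis using p by (simp add: p_def c_def field_simps power2_eq_square)
qed

lemma tail_moment_pi: "tail_moment 0 pi = 1" "tail_moment 1 pi = 5 / 3" "tail_moment 2 pi = 25"
  by (simp_all add: tail_moment_def)

section \<open>Optimal designs for the t-distribution\<close>

lemma D_optimal_student_t_iff:
  fixes a d \<alpha> m2 m4 :: real
  assumes S: "S \<in> sets borel" "\<And>x. - x \<in> S \<longleftrightarrow> x \<in> S"
      "\<And>x. 0 < (x\<^sup>2 - a\<^sup>2) * (x\<^sup>2 - d) \<Longrightarrow> x \<in> S" "\<And>x. (x\<^sup>2 - a\<^sup>2) * (x\<^sup>2 - d) < 0 \<Longrightarrow> x \<notin> S"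
    and "0 < \<alpha>"
    and m: "has_bochner_integral lborel (\<lambda>x. student_t_density 5 x * indicator S x) \<alpha>"
      "has_bochner_integral lborel (\<lambda>x. x\<^sup>2 * (student_t_density 5 x * indicator S x)) m2"
      "has_bochner_integral lborel (\<lambda>x. x ^ 4 * (student_t_density 5 x * indicator S x)) m4"
    and eq: "\<alpha> * (a\<^sup>2 + d) * m2 = 3 * m2\<^sup>2 - \<alpha> * m4"
  shows "D_optimal (student_t_density 5) \<alpha> \<xi> \<longleftrightarrow>
    \<xi> = density lborel (\<lambda>x. ennreal (student_t_density 5 x * indicator S x))"
proof (rule D_optimal_iff_threshold[OF _ _ _ _ _ S \<open>0 < \<alpha>\<close>])
  show "student_t_density 5 \<in> borel_measurable borel"
    unfolding student_t_density_5[abs_def] by measurable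
  show "0 \<le> student_t_density 5 x" for x
    unfolding student_t_density_5 by (intro divide_nonneg_nonneg) auto
  show "student_t_density 5 (- x) = student_t_density 5 x" for x
    by (simp add: student_t_density_5)
  have all: "tails (0 :: real) = UNIV" by auto
  show "integrable lborel (student_t_density 5)"
    using has_bochner_integral_tails[of 0 0] unfolding all by (simp add: has_bochner_integral_iff)
  show "integrable lborel (\<lambda>x. x ^ 4 * student_t_density 5 x)"
    using has_bochner_integral_tails[of 2 0] unfolding all by (simp add: has_bochner_integral_iff)
qed (use m eq in \<open>auto dest!: has_bochner_integral_integral_eq\<close>)

text \<open>The root \<open>d\<close> is determined by the optimality equation, and
  \<open>crit_eq_moments\<close> turns \<open>0 \<le> crit y\<close> into \<open>d \<le> 0\<close>.
  Then \<open>x^2 - d\<close> is never negative, and the sign of the polynomial is decided by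
  \<open>x^2 - a^2\<close> alone.\<close>

lemma two_tailed_design_optimal:
  assumes y: "0 < y" "y < pi" and crit: "0 \<le> crit y"
  shows "D_optimal (student_t_density 5) (tail_moment 0 y) \<xi> \<longleftrightarrow>
    \<xi> = density lborel (\<lambda>x. ennreal (student_t_density 5 x * indicator (tails (threshold y)) x))"
proof -
  define a where "a = threshold y"
  let ?m = "\<lambda>j. tail_moment j y"
  have a: "0 < a" using threshold_less[of y pi] y by (simp add: a_def)
  have ang: "angle a = y" using y by (simp add: a_def angle_threshold)
  have m_pos: "0 < ?m j" if "j \<le> 2" for j
    using tail_moment_less[OF that, of 0 y] y by simp
  define d where "d = (3 * (?m 1)\<^sup>2 - ?m 0 * ?m 2) / (?m 0 * ?m 1) - a\<^sup>2"
  have "?m 0 * (a\<^sup>2 + d) * ?m 1 = (a\<^sup>2 + d) * (?m 0 * ?m 1)" by simp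
  also have "\<dots> = 3 * (?m 1)\<^sup>2 - ?m 0 * ?m 2"
    unfolding d_def using m_pos[of 0] m_pos[of 1] by simp
  finally have eq: "?m 0 * (a\<^sup>2 + d) * ?m 1 = 3 * (?m 1)\<^sup>2 - ?m 0 * ?m 2" .
  have c: "cos y < 1" using y by (intro cos_less_one) auto
  have "(threshold y)\<^sup>2 * (1 - cos y) = 5 * (1 + cos y)" using y by (intro threshold_square) auto
  then have "(1 - cos y) * (?m 0 * d * ?m 1) = - (25 / (9 * pi\<^sup>2) * crit y)"
    using eq unfolding crit_eq_moments[symmetric] a_def by algebra
  then have "(1 - cos y) * (?m 0 * d * ?m 1) \<le> 0" using crit by simp
  then have d: "d \<le> 0" using c m_pos[of 0] m_pos[of 1] by (simp add: mult_le_0_iff)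
  note hb = has_bochner_integral_tails[OF _ less_imp_le[OF a], unfolded ang]
  show ?thesis unfolding a_def[symmetric]
  proof (rule D_optimal_student_t_iff[OF _ _ _ _ m_pos _ _ _ eq])
    show "x \<in> tails a" if "0 < (x\<^sup>2 - a\<^sup>2) * (x\<^sup>2 - d)" for x
    proof -
      have "a\<^sup>2 < x\<^sup>2" using that d zero_le_power2[of x] by (auto simp: zero_less_mult_iff)
      then have "a < \<bar>x\<bar>" using a by (simp add: abs_le_square_iff[symmetric] flip: not_le)
      then show ?thesis by auto
    qed
    show "x \<notin> tails a" if "(x\<^sup>2 - a\<^sup>2) * (x\<^sup>2 - d) < 0" for x
    proof -
      have "x\<^sup>2 < a\<^sup>2" using that d zero_le_power2[of x] by (auto simp: mult_less_0_iff)
      then have "\<bar>x\<bar> < a" using a by (simp add: abs_le_square_iff[symmetric] flip: not_le)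
      then show ?thesis by auto
    qed
  qed (use hb[of 0] hb[of 1] hb[of 2] in auto)
qed

text \<open>The mass \<open>p\<close> of the outer tails parametrizes the pairs
  \<open>(a, b)\<close> with total mass \<open>\<alpha>\<close>. The optimality equation with
  \<open>d = b^2\<close> is solved by the intermediate value theorem between \<open>p = 0\<close>
  and \<open>p = \<alpha>\<close>.\<close>

lemma three_piece_design_optimal:
  assumes y: "0 < y" "y < pi" and crit: "crit y < 0"
  shows "\<exists>a b. b < a \<and> 0 < b \<and> (\<forall>\<xi>. D_optimal (student_t_density 5) (tail_moment 0 y) \<xi> \<longleftrightarrow>
    \<xi> = density lborel (\<lambda>x. ennreal (student_t_density 5 x * indicator ({..- a} \<union> {- b..b} \<union> {a..}) x)))"
proof -
  define \<alpha> where "\<alpha> = tail_moment 0 y"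
  \<comment> \<open>\<open>Q p\<close> is the angle at which the two tails have mass
    \<open>p\<close>.\<close>
  define Q where "Q = the_inv_into {0..pi} (tail_moment 0)"
  have cont: "continuous_on A (tail_moment j)" for A j
    unfolding tail_moment_def[abs_def] by (intro continuous_intros) auto
  have mono: "tail_moment j u < tail_moment j v" if "j \<le> 2" "0 \<le> u" "u < v" "v \<le> pi" for j u v
    using that by (intro tail_moment_less) auto
  have inj: "inj_on (tail_moment 0) {0..pi}"
    using mono[of 0] by (intro linorder_inj_onI) force+
  have Q_tm: "Q (tail_moment 0 u) = u" if "u \<in> {0..pi}" for u
    using the_inv_into_f_f[OF inj that] by (simp add: Q_def)
  have tm_Q: "Q p \<in> {0..pi} \<and> tail_moment 0 (Q p) = p" if "0 \<le> p" "p \<le> 1" for p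
  proof -
    have "\<exists>u\<ge>0. u \<le> pi \<and> tail_moment 0 u = p"
      using that by (intro IVT' cont) (simp_all add: tail_moment_pi)
    then show ?thesis using Q_tm by fastforce
  qed
  have \<alpha>: "0 < \<alpha>" "\<alpha> < 1"
    using mono[of 0 0 y] mono[of 0 y pi] y by (auto simp: \<alpha>_def tail_moment_pi)
  have cont_Q: "continuous_on {0..1} Q"
  proof -
    have "continuous_on (tail_moment 0 ` {0..pi}) Q"
      using Q_tm cont by (intro continuous_on_inv) auto
    moreover have "{0..1} \<subseteq> tail_moment 0 ` {0..pi}"
      using tm_Q by (force simp: image_iff)
    ultimately show ?thesis by (rule continuous_on_subset)
  qed
  have Q_less: "Q u < Q v" if "0 \<le> u" "u < v" "v \<le> 1" for u v
    using tm_Q[of u] tm_Q[of v] mono[of 0 "Q v" "Q u"] that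
    by (cases "Q u" "Q v" rule: linorder_cases) auto
  \<comment> \<open>The centre must have mass \<open>\<alpha> - p\<close>, so the tails beyond
    \<open>b\<close> have mass \<open>1 - (\<alpha> - p)\<close>.\<close>
  define B where "B p = Q (p + 1 - \<alpha>)" for p
  define m where "m j p = tail_moment j (Q p) + (tail_moment j pi - tail_moment j (B p))" for j p
  \<comment> \<open>The difference of the two sides of the optimality equation, multiplied by
    \<open>1 - cos (Q p)\<close>: the threshold \<open>a\<close> becomes infinite as
    \<open>p\<close> tends to 0, and this factor keeps \<open>H\<close> continuous there.\<close>
  define H where "H p = \<alpha> * (5 * (1 + cos (Q p)) + (1 - cos (Q p)) * (5 * (1 + cos (B p)) / (1 - cos (B p)))) * m 1 p
      + (1 - cos (Q p)) * (\<alpha> * m 2 p - 3 * (m 1 p)\<^sup>2)" for p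
  have B: "0 < B p" "B p \<le> pi" "Q p < B p" if "0 \<le> p" "p \<le> \<alpha>" for p
    using Q_less[of p "p + 1 - \<alpha>"] tm_Q[of p] tm_Q[of "p + 1 - \<alpha>"] that \<alpha>
    by (auto simp: B_def)
  have cos_B: "cos (B p) < 1" if "0 \<le> p" "p \<le> \<alpha>" for p
    using B[OF that] by (intro cos_less_one) auto
  have Q0: "Q 0 = 0" and Q\<alpha>: "Q \<alpha> = y" and Q1: "Q 1 = pi"
    using Q_tm[of 0] Q_tm[of y] Q_tm[of pi] y by (auto simp: \<alpha>_def tail_moment_pi)
  have cQ: "continuous_on {0..\<alpha>} Q"
    using cont_Q by (rule continuous_on_subset) (use \<alpha> in auto)
  have cB: "continuous_on {0..\<alpha>} B"
    unfolding B_def[abs_def] using \<alpha>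
    by (intro continuous_on_compose2[OF cont_Q] continuous_intros) auto
  have cm: "continuous_on {0..\<alpha>} (m j)" for j
    unfolding m_def[abs_def]
    by (intro continuous_intros continuous_on_compose2[OF cont[of UNIV]] cQ cB) auto
  have cH: "continuous_on {0..\<alpha>} H"
    unfolding H_def[abs_def] using cos_B
    by (intro continuous_intros cQ cB cm) force
  \<comment> \<open>At \<open>p = \<alpha>\<close> the centre has mass 0 and \<open>b = 0\<close>,
    so the two-tailed design is recovered.\<close>
  have "H \<alpha> = 25 / (9 * pi\<^sup>2) * crit y"
    unfolding crit_eq_moments[symmetric] \<alpha>_def[symmetric]
    by (simp add: H_def m_def B_def Q1 Q\<alpha> algebra_simps)
  then have "H \<alpha> < 0" using crit by (auto intro!: divide_neg_pos)
  \<comment> \<open>At \<open>p = 0\<close> the tails are empty and \<open>cos (Q 0) = 1\<close>, so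
    only \<open>10 * \<alpha> * m 1 0\<close> remains.\<close>
  moreover have "0 < H 0"
  proof -
    have "B 0 < pi" using Q_less[of "1 - \<alpha>" 1] \<alpha> by (simp add: B_def Q1)
    then have "0 < m 1 0" using mono[of 1 "B 0" pi] B[of 0] \<alpha> by (simp add: m_def Q0)
    then show ?thesis using \<alpha> by (simp add: H_def Q0)
  qed
  ultimately obtain p where p: "0 \<le> p" "p \<le> \<alpha>" "H p = 0"
    using IVT2'[of H \<alpha> 0 0] cH \<alpha> by auto
  have p': "0 < p" "p < \<alpha>"
    using p \<open>H \<alpha> < 0\<close> \<open>0 < H 0\<close> by (auto simp: order.strict_iff_order)
  define a b where "a = threshold (Q p)" and "b = threshold (B p)"
  have Qp: "0 < Q p" "Q p \<le> pi"
    using Q_less[of 0 p] tm_Q[of p] p' \<alpha> by (auto simp: Q0)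
  have Bp: "B p < pi" using Q_less[of "p + 1 - \<alpha>" 1] p' \<alpha> by (simp add: B_def Q1)
  have ab: "0 < b" "b < a"
    using threshold_less[of "B p" pi] threshold_less[of "Q p" "B p"] B[OF p(1,2)] Bp Qp by (auto simp: a_def b_def)
  have ang: "angle a = Q p" "angle b = B p"
    using Qp Bp B[OF p(1,2)] pi_gt_zero by (auto simp: a_def b_def intro!: angle_threshold simp del: pi_gt_zero)
  note hb = has_bochner_integral_tails_centre[OF _ less_imp_le[OF ab(1)] ab(2), unfolded ang, folded m_def]
  have m0: "m 0 p = \<alpha>"
    using tm_Q[of p] tm_Q[of "p + 1 - \<alpha>"] p \<alpha> by (simp add: m_def B_def tail_moment_pi)
  have ca: "cos (Q p) < 1" using Qp pi_gt_zero by (intro cos_less_one) auto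
  have b2: "5 * (1 + cos (B p)) / (1 - cos (B p)) = b\<^sup>2"
    using threshold_square[of "B p"] B[OF p(1,2)] cos_B[OF p(1,2)] by (simp add: b_def divide_simps)
  have a2: "5 * (1 + cos (Q p)) = a\<^sup>2 * (1 - cos (Q p))"
    using threshold_square[of "Q p"] Qp by (simp add: a_def)
  have "(1 - cos (Q p)) * (\<alpha> * (a\<^sup>2 + b\<^sup>2) * m 1 p - (3 * (m 1 p)\<^sup>2 - \<alpha> * m 2 p)) = H p"
    unfolding H_def b2 a2 by algebra
  then have eq: "\<alpha> * (a\<^sup>2 + b\<^sup>2) * m 1 p = 3 * (m 1 p)\<^sup>2 - \<alpha> * m 2 p"
    using p ca by simp
  let ?S = "{..- a} \<union> {- b..b} \<union> {a..}"
  have "D_optimal (student_t_density 5) \<alpha> \<xi> \<longleftrightarrow>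
      \<xi> = density lborel (\<lambda>x. ennreal (student_t_density 5 x * indicator ?S x))" for \<xi>
  proof (rule D_optimal_student_t_iff[OF _ _ _ _ \<alpha>(1) _ _ _ eq])
    have sq: "x\<^sup>2 < r\<^sup>2 \<longleftrightarrow> \<bar>x\<bar> < r" "r\<^sup>2 < x\<^sup>2 \<longleftrightarrow> r < \<bar>x\<bar>" if "0 < r" for x r :: real
      using that abs_le_square_iff[of r x] abs_le_square_iff[of x r] by (auto simp flip: not_le)
    show "x \<in> ?S" if "0 < (x\<^sup>2 - a\<^sup>2) * (x\<^sup>2 - b\<^sup>2)" for x
      using that ab sq[of a x] sq[of b x] by (auto simp: zero_less_mult_iff)
    show "x \<notin> ?S" if "(x\<^sup>2 - a\<^sup>2) * (x\<^sup>2 - b\<^sup>2) < 0" for x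
      using that ab sq[of a x] sq[of b x] by (auto simp: mult_less_0_iff)
  qed (use hb[of 0] hb[of 1] hb[of 2] ab in \<open>auto simp: m0\<close>)
  then show ?thesis using ab unfolding \<alpha>_def by blast
qed

theorem theorem5p6:
  defines "fX \<equiv> student_t_density 5"
  shows "\<exists>\<alpha>star::real. \<bar>\<alpha>star - 0.082065\<bar> < 0.000005 \<and>
    (\<forall>\<alpha>::real. 0 < \<alpha> \<and> \<alpha> < 1 \<longrightarrow>
      (\<alpha> < \<alpha>star \<longrightarrow>
        (\<exists>a b::real. a > b \<and> b > 0 \<and>
          (\<forall>\<xi>. D_optimal fX \<alpha> \<xi> \<longleftrightarrow>
             \<xi> = density lborel
                   (\<lambda>x. ennreal (fX x * indicator ({..-a} \<union> {-b..b} \<union> {a..}) x))))) \<and>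
      (\<alpha> \<ge> \<alpha>star \<longrightarrow>
        (\<forall>\<xi>. D_optimal fX \<alpha> \<xi> \<longleftrightarrow>
           \<xi> = density lborel
                 (\<lambda>x. ennreal (fX x *
                    indicator ({..- quantile (student_t 5) (1 - \<alpha> / 2)} \<union>
                               {quantile (student_t 5) (1 - \<alpha> / 2)..}) x)))))"
proof -
  obtain ys where ys: "0 < ys" "ys < pi" "\<And>y. 0 < y \<Longrightarrow> y < pi \<Longrightarrow> crit y < 0 \<longleftrightarrow> y < ys"
    using crit_sign by blast
  have mono: "tail_moment 0 u < tail_moment 0 v" if "0 \<le> u" "u < v" "v \<le> pi" for u v
    using that by (intro tail_moment_less) auto
  define y1 y2 where "y1 = pi / 2 + 2 * arctan 0.01482" and "y2 = pi / 2 + 2 * arctan 0.0148312"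
  note bracket = crit_bracket[folded y1_def y2_def]
  have y12: "0 < y1" "y1 < pi" "0 < y2" "y2 < pi"
    using arctan_less_self[of "0.01482"] arctan_less_self[of "0.0148312"] pi_bounds
    by (auto simp: y1_def y2_def add_pos_pos)
  have "y1 < ys" using bracket(1) ys(3)[of y1] y12 by simp
  moreover have "ys \<le> y2" using bracket(2) ys(3)[of y2] y12 by (simp add: not_less flip: not_le)
  ultimately have near: "0.08206 < tail_moment 0 ys" "tail_moment 0 ys < 0.08207"
    using bracket(3,4) mono[of y1 ys] mono[of ys y2] ys y12 by (cases "ys = y2"; force)+
  \<comment> \<open>Every proportion is the tail mass at some angle in \<open>(0, pi)\<close>, so
    both cases can be treated in terms of \<open>y\<close>.\<close>
  have ex: "\<exists>y. 0 < y \<and> y < pi \<and> tail_moment 0 y = \<alpha>" if "0 < \<alpha>" "\<alpha> < 1" for \<alpha>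
  proof -
    have "continuous_on {0..pi} (tail_moment 0)"
      unfolding tail_moment_def[abs_def] by (intro continuous_intros) auto
    then have "\<exists>y\<ge>0. y \<le> pi \<and> tail_moment 0 y = \<alpha>"
      using that by (intro IVT') (simp_all add: tail_moment_pi)
    then show ?thesis using that tail_moment_pi(1) by (metis order.strict_iff_order tail_moment_0)
  qed
  have three: "\<exists>a b::real. a > b \<and> b > 0 \<and> (\<forall>\<xi>. D_optimal fX (tail_moment 0 y) \<xi> \<longleftrightarrow>
             \<xi> = density lborel
                   (\<lambda>x. ennreal (fX x * indicator ({..-a} \<union> {-b..b} \<union> {a..}) x)))"
    if "0 < y" "y < pi" "tail_moment 0 y < tail_moment 0 ys" for y
  proof -
    have "y < ys" using mono[of ys y] that ys by (cases y ys rule: linorder_cases) auto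
    then have "crit y < 0" using ys(3) that by simp
    then show ?thesis unfolding fX_def using three_piece_design_optimal[OF that(1,2)] by blast
  qed
  have two: "D_optimal fX (tail_moment 0 y) \<xi> \<longleftrightarrow> \<xi> = density lborel
                 (\<lambda>x. ennreal (fX x *
                    indicator (tails (quantile (student_t 5) (1 - tail_moment 0 y / 2))) x))"
    if "0 < y" "y < pi" "tail_moment 0 ys \<le> tail_moment 0 y" for y \<xi>
  proof -
    have "ys \<le> y" using mono[of y ys] that ys by (cases y ys rule: linorder_cases) auto
    then have "0 \<le> crit y" using ys(3)[of y] that by simp
    moreover have "quantile (student_t 5) (1 - tail_moment 0 y / 2) = threshold y"
      using quantile_student_t_5[of "threshold y"] angle_threshold[of y] that by simp
    ultimately show ?thesis
      unfolding fX_def using two_tailed_design_optimal[OF that(1,2)] by simp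
  qed
  show ?thesis
  \<comment> \<open>The critical proportion is the tail mass at the sign change of
    \<open>crit\<close>; as the tail mass increases with the angle, comparing proportions amounts to
    comparing \<open>y\<close> with \<open>ys\<close>.\<close>
  proof (rule exI[of _ "tail_moment 0 ys"], intro conjI allI impI, goal_cases)
    case 1
    then show ?case using near unfolding abs_less_iff by simp
  next
    case (2 \<alpha>)
    then obtain y where y: "0 < y" "y < pi" "tail_moment 0 y = \<alpha>" using ex by blast
    show ?case using three[OF y(1,2)] 2(2) unfolding y(3)[symmetric] by blast
  next
    case (3 \<alpha> \<xi>)
    then obtain y where y: "0 < y" "y < pi" "tail_moment 0 y = \<alpha>" using ex by blast
    show ?case using two[OF y(1,2)] 3(2) unfolding y(3)[symmetric] by blast
  qed
qed

end
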